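(* In the uplink of the scalable cell-free massive MIMO system with hardware impairments described in the context, the uplink average spectral efficiency (SE) for user $k$ is lower bounded by $$\mathrm{SE}_k^{\mathrm{lo}}=\frac1{\tau_{\mathrm c}}\sum_{n=1}^{\tau_{\mathrm c}-\tau_{\mathrm p}}\log_2\big(1+\tilde\gamma^{\mathrm{lo}}_{k,n}\big),\qquad \tilde\gamma^{\mathrm{lo}}_{k,n}=\frac{S_{k,n}}{I_{k,n}},$$ where $S_{k,n}$ and $I_{k,n}$ are the desired signal power and the interference plus noise power, respectively, defined as $$S_{k,n}=\rho_k\big|\mathbb E\{\mathbf v_{k,n}^{\mathsf H}\mathbf D_k\mathbf h_{k,n}\}\big|^2,$$ $$I_{k,n}=\rho_k\mathrm{Var}\{\mathbf v_{k,n}^{\mathsf H}\mathbf D_k\mathbf h_{k,n}\}+\sum_{i\ne k}^K\rho_i\,\mathbb E\{|\mathbf v_{k,n}^{\mathsf H}\mathbf D_k\mathbf h_{i,n}|^2\}+\sigma_{\mathrm t}^2+\sigma_{\mathrm r}^2+\xi\,\mathbb E\{\|\mathbf v_{k,n}^{\mathsf H}\mathbf D_k\|^2\},$$ and $$\sigma_{\mathrm t}^2=\sum_{i=1}^K\kappa_{\mathrm t}^2\rho_i\,\mathbb E\{|\mathbf v_{k,n}^{\mathsf H}\mathbf D_k\mathbf h_{i,n}|^2\},\qquad \sigma_{\mathrm r}^2=\mathbb E\Big\{\mathbf v_{k,n}^{\mathsf H}\mathbf D_k\boldsymbol\kappa_{\mathrm r}^2\Big(\sum_{i=1}^K\rho_i\mathbf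 F_{|\mathbf h_i|^2}\Big)\mathbf D_k\mathbf v_{k,n}\Big\}$$ are the variances of the components corresponding to the additive hardware impairments at the transmit side and at the receive side (output of the decoder), respectively.
   Context: Network: $M$ access points (APs) with $L$ antennas each, $W=ML$, and $K$ single-antenna users. Each coherence block has $\tau_{\mathrm c}$ channel uses, of which $\tau_{\mathrm p}$ are used for uplink pilots and the remaining $\tau_{\mathrm c}-\tau_{\mathrm p}$ for uplink data; $n$ in the sum indexes the data channel uses. The ergodic capacity of this system is unknown; one SE is obtained for each channel use $n$ of the data transmission phase and the average over channel uses is taken, which gives a lower bound on the uplink capacity. $(\cdot)^{\mathsf H}$ is the conjugate transpose; $\mathrm{Var}\{X\}=\mathbb E|X-\mathbb EX|^2$; expectations are over the channel vectors and the noise processes. Channel: $\mathbf h_i\sim\mathcal{CN}(\mathbf 0,\mathbf R_i)$ in $\mathbb C^W$ is the concatenated channel of user $i$ to all APs (independent correlated Rayleigh fading), with $\mathbf R_i$ block diagonal with $M$ blocks of size $L\times L$. Phase noise: $\boldsymbol\Theta_{i,n}$ is the $W\times W$ diagonal matrix whose entry for antenna $j$ of AP $m$ is the complex exponential $e^{\mathrm i(\phi^j_{m,n}+\varphi_{i,n})}$, where $\phi^j_{m,n}$ (AP oscillator) and $\varphi_{i,n}$ (user oscillator) are discrete-time Wiener processes in $n$ with Gaussian increments of variances $\sigma_\phi^2$ and $\sigma_\varphi^2$; the AP processes are independent over antennas (separate oscillators) or identical over the antennas of an AP (common oscillator). The effective channel is $\mathbf h_{i,n}=\boldsymbol\Theta_{i,n}\mathbf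 h_i$. Received signal at data channel use $n$: $\mathbf y_n=\sum_{i=1}^K\mathbf h_{i,n}(s_{i,n}+\delta^i_{\mathrm t,n})+\boldsymbol\delta_{\mathrm r,n}+\boldsymbol\xi_n$, where $s_{i,n}\in\mathbb C$ is the transmit signal of user $i$ with power $\rho_i$; $\delta^i_{\mathrm t,n}\sim\mathcal{CN}(0,\kappa_{\mathrm t}^2\rho_i)$ is the additive transmit distortion; $\boldsymbol\delta_{\mathrm r,n}$ is the additive receive distortion, which given the channel realizations is $\mathcal{CN}(\mathbf 0,\boldsymbol\kappa_{\mathrm r}^2\sum_{i=1}^K\rho_i\mathbf F_{|\mathbf h_i|^2})$; and $\boldsymbol\xi_n\sim\mathcal{CN}(\mathbf 0,\xi\mathbf I_W)$ is the amplified thermal noise, independent of the channels. Here $\boldsymbol\kappa_{\mathrm r}^2=\mathrm{diag}(\kappa_{\mathrm r_1}^2\mathbf I_L,\dots,\kappa_{\mathrm r_M}^2\mathbf I_L)$, and $\mathbf F_{|\mathbf h_i|^2}$ is the diagonal matrix of the squared moduli of the entries of $\mathbf h_i$. Combining: $\mathbf D_k$ is the $W\times W$ block-diagonal matrix whose $m$-th $L\times L$ block is $\mathbf I_L$ if AP $m$ serves user $k$ and $\mathbf 0$ otherwise. $\mathbf v_{k,n}\in\mathbb C^W$ is the collective combining vector for user $k$, and the network's estimate of $s_{k,n}$ is $\hat s_{k,n}=\mathbf v_{k,n}^{\mathsf H}\mathbf D_k\mathbf y_n$. *)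

theory Defs
  imports "HOL-Probability.Probability"
begin

text \<open>Defined by scaling a standard normal variable, so that variance 0 gives a point mass.\<close>

definition real_normal :: "real \<Rightarrow> real measure" where
  "real_normal v = distr (density lborel (\<lambda>x. ennreal (std_normal_density x))) borel (\<lambda>x. sqrt v * x)"

text \<open>The circularly symmetric law \<open>CN(0,v)\<close>: independent real and imaginary parts of
  variance \<open>v/2\<close> each.\<close>

definition complex_normal :: "real \<Rightarrow> complex measure" where
  "complex_normal v =
     distr (real_normal (v / 2) \<Otimes>\<^sub>M real_normal (v / 2)) borel (\<lambda>(x, y). Complex x y)"

definition herm_form :: "complex ^ 'n \<Rightarrow> complex ^ 'n ^ 'n \<Rightarrow> complex" where
  "herm_form u A = (\<Sum>a\<in>UNIV. \<Sum>b\<in>UNIV. cnj (u $ a) * A $ a $ b * u $ b)"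

definition covariance_matrix :: "complex ^ 'n ^ 'n \<Rightarrow> bool" where
  "covariance_matrix A \<longleftrightarrow>
     (\<forall>a b. A $ b $ a = cnj (A $ a $ b)) \<and> (\<forall>u. 0 \<le> Re (herm_form u A))"

text \<open>\<open>N\<close> is the law \<open>CN(0,A)\<close> of a circularly symmetric Gaussian vector: every linear functional
  \<open>u\<^sup>H x\<close> is \<open>CN(0, u\<^sup>H A u)\<close>. The matrix \<open>A\<close> may be singular.\<close>

definition complex_normal_vec :: "(complex ^ 'n) measure \<Rightarrow> complex ^ 'n ^ 'n \<Rightarrow> bool" where
  "complex_normal_vec N A \<longleftrightarrow> covariance_matrix A \<and> sets N = sets borel \<and>
     (\<forall>u. distr N borel (\<lambda>x. \<Sum>a\<in>UNIV. cnj (u $ a) * x $ a) = complex_normal (Re (herm_form u A)))"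

definition complex_variance :: "'w measure \<Rightarrow> ('w \<Rightarrow> complex) \<Rightarrow> real" where
  "complex_variance M X = (LINT \<omega>|M. (norm (X \<omega> - (LINT \<omega>'|M. X \<omega>')))\<^sup>2)"

definition wiener_process :: "'w measure \<Rightarrow> real \<Rightarrow> (nat \<Rightarrow> 'w \<Rightarrow> real) \<Rightarrow> bool" where
  "wiener_process M v X \<longleftrightarrow>
     (\<forall>n. X n \<in> borel_measurable M) \<and>
     (\<forall>n. distr M borel (\<lambda>\<omega>. X (Suc n) \<omega> - X n \<omega>) = real_normal v) \<and>
     prob_space.indep_vars M (\<lambda>_. borel)
       (\<lambda>n. case n of 0 \<Rightarrow> X 0 | Suc m \<Rightarrow> (\<lambda>\<omega>. X (Suc m) \<omega> - X m \<omega>)) UNIV"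

text \<open>The library's mutual information is a Bochner integral, hence a meaningless real number when
  the relative entropy of the joint law with respect to the product of the marginals is infinite.
  That happens exactly when absolute continuity or integrability of the log-likelihood ratio
  fails (the negative part of the ratio is always integrable under the joint law).\<close>

definition mutual_info :: "'w measure \<Rightarrow> ('w \<Rightarrow> complex) \<Rightarrow> ('w \<Rightarrow> complex) \<Rightarrow> ereal" where
  "mutual_info M X Y =
    (let Q = distr M borel X \<Otimes>\<^sub>M distr M borel Y;
         J = distr M (borel \<Otimes>\<^sub>M borel) (\<lambda>\<omega>. (X \<omega>, Y \<omega>))
     in if absolutely_continuous Q J \<and> integrable J (entropy_density 2 Q J)
        then ereal (prob_space.mutual_information M 2 borel borel X Y)
        else \<infinity>)"

text \<open>\<open>'m\<close> indexes the access points, \<open>'l\<close> the antennas of one access point, \<open>'u\<close> the users, and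
  \<open>'m \<times> 'l\<close> all antennas. The natural-number arguments are data channel uses. \<open>signal U i n\<close> is
  the transmit signal of user \<open>i\<close>, \<open>combiner U k n\<close> the collective combining vector for user \<open>k\<close>.\<close>

record ('w, 'm, 'l, 'u) uplink =
  PS :: "'w measure"
  block_len :: nat
  pilot_len :: nat
  power :: "'u \<Rightarrow> real"
  tx_impair :: real
  rx_impair :: "'m \<Rightarrow> real"
  noise_var :: real
  ap_phase_var :: real
  ue_phase_var :: real
  chan_cov :: "'u \<Rightarrow> complex ^ ('m \<times> 'l) ^ ('m \<times> 'l)"
  serves :: "'m \<Rightarrow> 'u \<Rightarrow> bool"
  chan :: "'u \<Rightarrow> 'w \<Rightarrow> complex ^ ('m \<times> 'l)"
  ap_phase :: "'m \<times> 'l \<Rightarrow> nat \<Rightarrow> 'w \<Rightarrow> real"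
  ue_phase :: "'u \<Rightarrow> nat \<Rightarrow> 'w \<Rightarrow> real"
  signal :: "'u \<Rightarrow> nat \<Rightarrow> 'w \<Rightarrow> complex"
  tx_dist :: "'u \<Rightarrow> nat \<Rightarrow> 'w \<Rightarrow> complex"
  rx_dist :: "nat \<Rightarrow> 'w \<Rightarrow> complex ^ ('m \<times> 'l)"
  noise :: "nat \<Rightarrow> 'w \<Rightarrow> complex ^ ('m \<times> 'l)"
  combiner :: "'u \<Rightarrow> nat \<Rightarrow> 'w \<Rightarrow> complex ^ ('m \<times> 'l)"

definition data_uses :: "('w, 'm::finite, 'l::finite, 'u::finite) uplink \<Rightarrow> nat set" where
  "data_uses U = {1..block_len U - pilot_len U}"

definition diag_mat :: "('n \<Rightarrow> complex) \<Rightarrow> complex ^ 'n ^ 'n" where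
  "diag_mat d = (\<chi> a b. if a = b then d a else 0)"

definition phase_mat ::
  "('w, 'm::finite, 'l::finite, 'u::finite) uplink \<Rightarrow> 'u \<Rightarrow> nat \<Rightarrow> 'w
     \<Rightarrow> complex ^ ('m \<times> 'l) ^ ('m \<times> 'l)" where
  "phase_mat U i n \<omega> = diag_mat (\<lambda>a. cis (ap_phase U a n \<omega> + ue_phase U i n \<omega>))"

definition eff_chan ::
  "('w, 'm::finite, 'l::finite, 'u::finite) uplink \<Rightarrow> 'u \<Rightarrow> nat \<Rightarrow> 'w \<Rightarrow> complex ^ ('m \<times> 'l)" where
  "eff_chan U i n \<omega> = phase_mat U i n \<omega> *v chan U i \<omega>"

definition serve_mat ::
  "('w, 'm::finite, 'l::finite, 'u::finite) uplink \<Rightarrow> 'u \<Rightarrow> complex ^ ('m \<times> 'l) ^ ('m \<times> 'l)" where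
  "serve_mat U k = diag_mat (\<lambda>(m, l). if serves U m k then 1 else 0)"

definition rx_impair_mat ::
  "('w, 'm::finite, 'l::finite, 'u::finite) uplink \<Rightarrow> complex ^ ('m \<times> 'l) ^ ('m \<times> 'l)" where
  "rx_impair_mat U = diag_mat (\<lambda>(m, l). complex_of_real ((rx_impair U m)\<^sup>2))"

definition rx_dist_cov ::
  "('w, 'm::finite, 'l::finite, 'u::finite) uplink \<Rightarrow> 'w \<Rightarrow> complex ^ ('m \<times> 'l) ^ ('m \<times> 'l)" where
  "rx_dist_cov U \<omega> = rx_impair_mat U **
     (\<Sum>i\<in>UNIV. power U i *\<^sub>R diag_mat (\<lambda>a. complex_of_real ((norm (chan U i \<omega> $ a))\<^sup>2)))"

text \<open>The row vector \<open>v\<^sub>k\<^sub>,\<^sub>n\<^sup>H D\<^sub>k\<close>, and the product of a row vector with a column vector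
  (no conjugation).\<close>

definition comb_row ::
  "('w, 'm::finite, 'l::finite, 'u::finite) uplink \<Rightarrow> 'u \<Rightarrow> nat \<Rightarrow> 'w \<Rightarrow> complex ^ ('m \<times> 'l)" where
  "comb_row U k n \<omega> = (\<chi> a. cnj (combiner U k n \<omega> $ a)) v* serve_mat U k"

definition row_mult :: "complex ^ 'n \<Rightarrow> complex ^ 'n \<Rightarrow> complex" where
  "row_mult r x = (\<Sum>a\<in>UNIV. r $ a * x $ a)"

definition received ::
  "('w, 'm::finite, 'l::finite, 'u::finite) uplink \<Rightarrow> nat \<Rightarrow> ('u \<Rightarrow> complex) \<Rightarrow> 'w
     \<Rightarrow> complex ^ ('m \<times> 'l)" where
  "received U n s \<omega> =
     (\<Sum>i\<in>UNIV. (s i + tx_dist U i n \<omega>) *s eff_chan U i n \<omega>) + rx_dist U n \<omega> + noise U n \<omega>"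

definition estimate ::
  "('w, 'm::finite, 'l::finite, 'u::finite) uplink \<Rightarrow> 'u \<Rightarrow> nat \<Rightarrow> ('u \<Rightarrow> complex) \<Rightarrow> 'w
     \<Rightarrow> complex" where
  "estimate U k n s \<omega> = row_mult (comb_row U k n \<omega>) (received U n s \<omega>)"

definition rv_events :: "'w measure \<Rightarrow> ('w \<Rightarrow> 'b::topological_space) \<Rightarrow> 'w set set" where
  "rv_events M X = {X -` A \<inter> space M | A. A \<in> sets borel}"

text \<open>At channel use \<open>n\<close>, \<open>Receiver\<close> stands for everything that is not generated by the data
  transmission itself: channels, phase noise and combining vectors. The latter are computed from
  pilots and may depend on channels and phase noise in any way.\<close>

datatype 'u source = Receiver | Signal 'u | Tx_Dist 'u | Noise

definition source_sigma ::
  "('w, 'm::finite, 'l::finite, 'u::finite) uplink \<Rightarrow> nat \<Rightarrow> 'u source \<Rightarrow> 'w set set" where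
  "source_sigma U n x = sigma_sets (space (PS U))
     (case x of
        Receiver \<Rightarrow>
          (\<Union>i. rv_events (PS U) (chan U i)) \<union>
          (\<Union>a t. rv_events (PS U) (ap_phase U a t)) \<union>
          (\<Union>i t. rv_events (PS U) (ue_phase U i t)) \<union>
          (\<Union>i. rv_events (PS U) (combiner U i n))
      | Signal i \<Rightarrow> rv_events (PS U) (signal U i n)
      | Tx_Dist i \<Rightarrow> rv_events (PS U) (tx_dist U i n)
      | Noise \<Rightarrow> rv_events (PS U) (noise U n))"

text \<open>\<open>X\<close> is conditionally \<open>CN(0, C)\<close> given the \<open>\<sigma>\<close>-algebra \<open>G\<close>: it has a regular conditional
  distribution \<open>\<kappa>\<close> with these values.\<close>

definition cond_complex_normal ::
  "'w measure \<Rightarrow> 'w set set \<Rightarrow> ('w \<Rightarrow> complex ^ 'n) \<Rightarrow> ('w \<Rightarrow> complex ^ 'n ^ 'n) \<Rightarrow> bool" where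
  "cond_complex_normal M G X C \<longleftrightarrow>
     (\<exists>\<kappa> \<in> sigma (space M) G \<rightarrow>\<^sub>M prob_algebra borel.
        (\<forall>\<omega>\<in>space M. complex_normal_vec (\<kappa> \<omega>) (C \<omega>)) \<and>
        (\<forall>A\<in>G. \<forall>B\<in>sets borel.
           emeasure M (A \<inter> X -` B) = (\<integral>\<^sup>+\<omega>\<in>A. emeasure (\<kappa> \<omega>) B \<partial>M)))"

definition parameters_ok :: "('w, 'm::finite, 'l::finite, 'u::finite) uplink \<Rightarrow> bool" where
  "parameters_ok U \<longleftrightarrow>
     0 < pilot_len U \<and> pilot_len U \<le> block_len U \<and>
     (\<forall>i. 0 \<le> power U i) \<and> 0 < noise_var U \<and> 0 \<le> ap_phase_var U \<and> 0 \<le> ue_phase_var U \<and>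
     (\<forall>i a b. fst a \<noteq> fst b \<longrightarrow> chan_cov U i $ a $ b = 0)"

definition channels_ok :: "('w, 'm::finite, 'l::finite, 'u::finite) uplink \<Rightarrow> bool" where
  "channels_ok U \<longleftrightarrow>
     (\<forall>i. chan U i \<in> borel_measurable (PS U)) \<and>
     prob_space.indep_vars (PS U) (\<lambda>_. borel) (chan U) UNIV \<and>
     (\<forall>i. complex_normal_vec (distr (PS U) borel (chan U i)) (chan_cov U i))"

definition indep_ap_oscillators ::
  "('w, 'm::finite, 'l::finite, 'u::finite) uplink \<Rightarrow> ('m \<times> 'l) set \<Rightarrow> bool" where
  "indep_ap_oscillators U I \<longleftrightarrow>
     prob_space.indep_sets (PS U)
       (\<lambda>a. sigma_sets (space (PS U)) (\<Union>n. rv_events (PS U) (ap_phase U a n))) I"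

definition separate_oscillators :: "('w, 'm::finite, 'l::finite, 'u::finite) uplink \<Rightarrow> bool" where
  "separate_oscillators U \<longleftrightarrow> indep_ap_oscillators U UNIV"

definition common_oscillators :: "('w, 'm::finite, 'l::finite, 'u::finite) uplink \<Rightarrow> bool" where
  "common_oscillators U \<longleftrightarrow>
     (\<forall>m j j'. ap_phase U (m, j) = ap_phase U (m, j')) \<and>
     (\<forall>j. indep_ap_oscillators U (UNIV \<times> {j}))"

definition phase_noise_ok :: "('w, 'm::finite, 'l::finite, 'u::finite) uplink \<Rightarrow> bool" where
  "phase_noise_ok U \<longleftrightarrow>
     (\<forall>a. wiener_process (PS U) (ap_phase_var U) (ap_phase U a)) \<and>
     (\<forall>i. wiener_process (PS U) (ue_phase_var U) (ue_phase U i)) \<and>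
     (separate_oscillators U \<or> common_oscillators U)"

text \<open>The receive distortion has the prescribed law conditionally on all other sources; its
  conditional covariance depends on the channels only.\<close>

definition data_phase_ok :: "('w, 'm::finite, 'l::finite, 'u::finite) uplink \<Rightarrow> nat \<Rightarrow> bool" where
  "data_phase_ok U n \<longleftrightarrow>
     (\<forall>i. combiner U i n \<in> borel_measurable (PS U)) \<and>
     (\<forall>i. signal U i n \<in> borel_measurable (PS U)) \<and>
     (\<forall>i. tx_dist U i n \<in> borel_measurable (PS U)) \<and>
     rx_dist U n \<in> borel_measurable (PS U) \<and>
     noise U n \<in> borel_measurable (PS U) \<and>
     prob_space.indep_sets (PS U) (source_sigma U n) UNIV \<and>
     (\<forall>i. integrable (PS U) (\<lambda>\<omega>. (norm (signal U i n \<omega>))\<^sup>2)) \<and>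
     (\<forall>i. (LINT \<omega>|PS U. signal U i n \<omega>) = 0) \<and>
     (\<forall>i. (LINT \<omega>|PS U. (norm (signal U i n \<omega>))\<^sup>2) = power U i) \<and>
     (\<forall>i. distr (PS U) borel (tx_dist U i n) = complex_normal ((tx_impair U)\<^sup>2 * power U i)) \<and>
     complex_normal_vec (distr (PS U) borel (noise U n)) (mat (complex_of_real (noise_var U))) \<and>
     cond_complex_normal (PS U) (sigma_sets (space (PS U)) (\<Union>x. source_sigma U n x))
       (rx_dist U n) (rx_dist_cov U)"

definition uplink_system :: "('w, 'm::finite, 'l::finite, 'u::finite) uplink \<Rightarrow> bool" where
  "uplink_system U \<longleftrightarrow>
     prob_space (PS U) \<and> parameters_ok U \<and> channels_ok U \<and> phase_noise_ok U \<and>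
     (\<forall>n\<in>data_uses U. data_phase_ok U n)"

text \<open>Coherence blocks are independent realisations of the system, so data channel use \<open>n\<close>, taken
  across blocks, is a memoryless channel from the symbol of user \<open>k\<close> to its estimate at the
  decoder. Its capacity is the supremum of the mutual information over input laws of power
  \<open>\<rho>\<^sub>k\<close>; the input \<open>x\<close> takes the place of \<open>signal U k n\<close> and is independent of everything else.\<close>

definition input_laws :: "real \<Rightarrow> complex measure set" where
  "input_laws p = {P. prob_space P \<and> sets P = sets borel \<and>
     integrable P (\<lambda>x. (norm x)\<^sup>2) \<and> (LINT x|P. (norm x)\<^sup>2) = p}"

definition channel_use_SE ::
  "('w, 'm::finite, 'l::finite, 'u::finite) uplink \<Rightarrow> 'u \<Rightarrow> nat \<Rightarrow> ereal" where
  "channel_use_SE U k n =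
     (SUP P\<in>input_laws (power U k).
        mutual_info (P \<Otimes>\<^sub>M PS U) fst
          (\<lambda>(x, \<omega>). estimate U k n ((\<lambda>i. signal U i n \<omega>)(k := x)) \<omega>))"

definition average_SE ::
  "('w, 'm::finite, 'l::finite, 'u::finite) uplink \<Rightarrow> 'u \<Rightarrow> ereal" where
  "average_SE U k = (\<Sum>n\<in>data_uses U. channel_use_SE U k n) / ereal (real (block_len U))"

abbreviation (input) gain ::
  "('w, 'm::finite, 'l::finite, 'u::finite) uplink \<Rightarrow> 'u \<Rightarrow> 'u \<Rightarrow> nat \<Rightarrow> 'w \<Rightarrow> complex" where
  "gain U k i n \<omega> \<equiv> row_mult (comb_row U k n \<omega>) (eff_chan U i n \<omega>)"

definition tx_dist_power ::
  "('w, 'm::finite, 'l::finite, 'u::finite) uplink \<Rightarrow> 'u \<Rightarrow> nat \<Rightarrow> real" where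
  "tx_dist_power U k n =
     (\<Sum>i\<in>UNIV. (tx_impair U)\<^sup>2 * power U i * (LINT \<omega>|PS U. (norm (gain U k i n \<omega>))\<^sup>2))"

definition rx_dist_form ::
  "('w, 'm::finite, 'l::finite, 'u::finite) uplink \<Rightarrow> 'u \<Rightarrow> nat \<Rightarrow> 'w \<Rightarrow> complex" where
  "rx_dist_form U k n \<omega> =
     row_mult (comb_row U k n \<omega>) (rx_dist_cov U \<omega> *v (serve_mat U k *v combiner U k n \<omega>))"

text \<open>The quadratic form is real, so taking the real part only changes the type.\<close>

definition rx_dist_power ::
  "('w, 'm::finite, 'l::finite, 'u::finite) uplink \<Rightarrow> 'u \<Rightarrow> nat \<Rightarrow> real" where
  "rx_dist_power U k n = Re (LINT \<omega>|PS U. rx_dist_form U k n \<omega>)"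

definition signal_power ::
  "('w, 'm::finite, 'l::finite, 'u::finite) uplink \<Rightarrow> 'u \<Rightarrow> nat \<Rightarrow> real" where
  "signal_power U k n = power U k * (norm (LINT \<omega>|PS U. gain U k k n \<omega>))\<^sup>2"

definition interference_power ::
  "('w, 'm::finite, 'l::finite, 'u::finite) uplink \<Rightarrow> 'u \<Rightarrow> nat \<Rightarrow> real" where
  "interference_power U k n =
     power U k * complex_variance (PS U) (gain U k k n) +
     (\<Sum>i\<in>UNIV - {k}. power U i * (LINT \<omega>|PS U. (norm (gain U k i n \<omega>))\<^sup>2)) +
     tx_dist_power U k n + rx_dist_power U k n +
     noise_var U * (LINT \<omega>|PS U. (norm (comb_row U k n \<omega>))\<^sup>2)"

text \<open>The denominator vanishes only if \<open>v\<^sub>k\<^sub>,\<^sub>n\<^sup>H D\<^sub>k = 0\<close> almost surely; then the numerator vanishes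
  as well and the quotient is 0.\<close>

definition SINR_lo ::
  "('w, 'm::finite, 'l::finite, 'u::finite) uplink \<Rightarrow> 'u \<Rightarrow> nat \<Rightarrow> real" where
  "SINR_lo U k n = signal_power U k n / interference_power U k n"

definition SE_lo :: "('w, 'm::finite, 'l::finite, 'u::finite) uplink \<Rightarrow> 'u \<Rightarrow> real" where
  "SE_lo U k = 1 / real (block_len U) * (\<Sum>n\<in>data_uses U. log 2 (1 + SINR_lo U k n))"

text \<open>The expectations in the bound are Bochner integrals, which default to 0 when they do not
  exist.\<close>

definition finite_moments ::
  "('w, 'm::finite, 'l::finite, 'u::finite) uplink \<Rightarrow> 'u \<Rightarrow> nat \<Rightarrow> bool" where
  "finite_moments U k n \<longleftrightarrow>
     (\<forall>i. integrable (PS U) (\<lambda>\<omega>. (norm (gain U k i n \<omega>))\<^sup>2)) \<and>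
     integrable (PS U) (rx_dist_form U k n) \<and>
     integrable (PS U) (\<lambda>\<omega>. (norm (comb_row U k n \<omega>))\<^sup>2)"

definition tx_dist_output ::
  "('w, 'm::finite, 'l::finite, 'u::finite) uplink \<Rightarrow> 'u \<Rightarrow> nat \<Rightarrow> 'w \<Rightarrow> complex" where
  "tx_dist_output U k n \<omega> =
     row_mult (comb_row U k n \<omega>) (\<Sum>i\<in>UNIV. tx_dist U i n \<omega> *s eff_chan U i n \<omega>)"

definition rx_dist_output ::
  "('w, 'm::finite, 'l::finite, 'u::finite) uplink \<Rightarrow> 'u \<Rightarrow> nat \<Rightarrow> 'w \<Rightarrow> complex" where
  "rx_dist_output U k n \<omega> = row_mult (comb_row U k n \<omega>) (rx_dist U n \<omega>)"

end

theory Submission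
  imports Defs
begin

text \<open>At each channel use the decoder output is \<open>Y = g x + Z\<close> with \<open>g = v\<^sup>H D h\<close>. Take
  \<open>x \<sim> CN(0,\<rho>)\<close> and bound the mutual information from below by \<open>E log (q(x|Y) / p(x))\<close>, where
  \<open>q(\<cdot>|y)\<close> is the Gaussian density around the linear MMSE estimate \<open>\<alpha> y\<close> whose variance is the mean
  square error \<open>\<rho> I / (S + I)\<close>. The expectation is exactly \<open>log (1 + S / I)\<close>, and only
  \<open>E g\<close>, \<open>E |g|\<^sup>2\<close> and \<open>E |Z|\<^sup>2\<close> enter. The power \<open>E |Z|\<^sup>2\<close> splits into the terms of \<open>I\<close> because each
  data-phase source is centred given the receiver and the sources added before it; the receive
  distortion, whose law is conditional on all others, is added last. If \<open>\<rho> = 0\<close> or \<open>I = 0\<close>, the ratio \<open>S / I\<close>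
  is 0 in HOL and nonnegativity of the mutual information suffices.\<close>

section \<open>Gaussian laws and centred laws\<close>

lemma prob_space_real_normal: "prob_space (real_normal v)"
  unfolding real_normal_def
  using prob_space_normal_density[of 1 0] by (intro prob_space.prob_space_distr) auto

lemma sets_real_normal[measurable_cong, simp]: "sets (real_normal v) = sets borel"
  by (simp add: real_normal_def)

lemma sets_complex_normal[measurable_cong, simp]: "sets (complex_normal v) = sets borel"
  by (simp add: complex_normal_def)

lemma borel_measurable_Complex[measurable (raw)]:
  "f \<in> borel_measurable M \<Longrightarrow> g \<in> borel_measurable M \<Longrightarrow> (\<lambda>x. Complex (f x) (g x)) \<in> borel_measurable M"
  by (simp add: borel_measurable_complex_iff)

lemma prob_space_complex_normal: "prob_space (complex_normal v)"
proof -
  interpret a: prob_space "real_normal (v/2)" by (rule prob_space_real_normal)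
  interpret pair_prob_space "real_normal (v/2)" "real_normal (v/2)" ..
  show ?thesis unfolding complex_normal_def by (intro prob_space_distr) measurable
qed

lemma real_normal_moments:
  assumes "0 \<le> v"
  shows "has_bochner_integral (real_normal v) (\<lambda>x. x) 0"
    and "has_bochner_integral (real_normal v) (\<lambda>x. x\<^sup>2) v"
proof -
  have "has_bochner_integral lborel (\<lambda>x. std_normal_density x * x) 0"
    using std_normal_moment_odd[of 0] by simp
  then have "has_bochner_integral lborel (\<lambda>x. sqrt v * (std_normal_density x * x)) (sqrt v * 0)"
    by (rule has_bochner_integral_mult_right)
  then show "has_bochner_integral (real_normal v) (\<lambda>x. x) 0"
    unfolding real_normal_def
    by (intro has_bochner_integral_distr has_bochner_integral_density) (auto simp: ac_simps)
  have "has_bochner_integral lborel (\<lambda>x. std_normal_density x * x\<^sup>2) 1"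
    using std_normal_moment_even[of 1] by (simp add: fact_numeral)
  then have "has_bochner_integral lborel (\<lambda>x. v * (std_normal_density x * x\<^sup>2)) (v * 1)"
    by (rule has_bochner_integral_mult_right)
  then show "has_bochner_integral (real_normal v) (\<lambda>x. x\<^sup>2) v"
    unfolding real_normal_def using assms
    by (intro has_bochner_integral_distr has_bochner_integral_density)
       (auto simp: ac_simps power_mult_distrib)
qed

lemma real_normal_eq_density:
  assumes "0 < v"
  shows "real_normal v = density lborel (\<lambda>x. ennreal (normal_density 0 (sqrt v) x))"
proof -
  let ?N = "density lborel (\<lambda>x. ennreal (std_normal_density x))"
  interpret prob_space ?N by (rule prob_space_normal_density) simp
  have "distributed ?N lborel (\<lambda>x. x) (normal_density 0 1)"
    unfolding distributed_def by (auto intro!: distr_id2 simp: sets_eq_imp_space_eq)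
  from normal_density_affine[OF this, of "sqrt v" 0]
  have "distributed ?N lborel (\<lambda>x. sqrt v * x) (normal_density 0 (sqrt v))"
    using assms by simp
  then have "distr ?N lborel (\<lambda>x. sqrt v * x) = density lborel (normal_density 0 (sqrt v))"
    by (simp add: distributed_def)
  moreover have "distr ?N lborel (\<lambda>x. sqrt v * x) = real_normal v"
    unfolding real_normal_def by (intro distr_cong) auto
  ultimately show ?thesis by simp
qed

lemma nn_integral_normal_density_ratio:
  assumes "0 < v" "0 < s"
  shows "(\<integral>\<^sup>+x. ennreal (normal_density m s x / normal_density 0 (sqrt v) x) \<partial>real_normal v) = 1"
proof -
  have "(\<integral>\<^sup>+x. ennreal (normal_density m s x / normal_density 0 (sqrt v) x) \<partial>real_normal v) =
     (\<integral>\<^sup>+x. ennreal (normal_density 0 (sqrt v) x) *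
        ennreal (normal_density m s x / normal_density 0 (sqrt v) x) \<partial>lborel)"
    by (simp add: real_normal_eq_density[OF assms(1)] nn_integral_density)
  also have "\<dots> = (\<integral>\<^sup>+x. ennreal (normal_density m s x) \<partial>lborel)"
  proof (intro nn_integral_cong)
    fix x
    have "0 < normal_density 0 (sqrt v) x" using assms by (simp add: normal_density_pos)
    then show "ennreal (normal_density 0 (sqrt v) x) *
        ennreal (normal_density m s x / normal_density 0 (sqrt v) x) = ennreal (normal_density m s x)"
      by (simp flip: ennreal_mult)
  qed
  also have "\<dots> = 1"
    using assms by (subst nn_integral_eq_integral) auto
  finally show ?thesis .
qed

section \<open>Density of the complex Gaussian law\<close>

definition complex_normal_density :: "complex \<Rightarrow> real \<Rightarrow> complex \<Rightarrow> real" where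
  "complex_normal_density m v z = exp (- (norm (z - m))\<^sup>2 / v) / (pi * v)"

lemma complex_normal_density_measurable[measurable (raw)]:
  assumes [measurable]: "f \<in> borel_measurable M" "g \<in> borel_measurable M"
  shows "(\<lambda>x. complex_normal_density (f x) v (g x)) \<in> borel_measurable M"
  unfolding complex_normal_density_def by measurable

lemma complex_normal_density_pos: "0 < v \<Longrightarrow> 0 < complex_normal_density m v z"
  by (simp add: complex_normal_density_def)

text \<open>Real and imaginary parts have variance \<open>v / 2\<close> each. The exponents add up
  to the squared modulus and the two square roots multiply to \<open>pi * v\<close>.\<close>

lemma complex_normal_density_eq:
  assumes "0 < v"
  shows "complex_normal_density m v z =
     normal_density (Re m) (sqrt (v / 2)) (Re z) * normal_density (Im m) (sqrt (v / 2)) (Im z)"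
proof -
  have n: "normal_density u (sqrt (v / 2)) x = exp (- (x - u)\<^sup>2 / v) / sqrt (pi * v)" for u x
    using assms by (simp add: normal_density_def)
  have "normal_density (Re m) (sqrt (v / 2)) (Re z) * normal_density (Im m) (sqrt (v / 2)) (Im z)
      = exp (- (Re z - Re m)\<^sup>2 / v) * exp (- (Im z - Im m)\<^sup>2 / v) / (sqrt (pi * v) * sqrt (pi * v))"
    unfolding n by simp
  also have "\<dots> = exp (- (Re z - Re m)\<^sup>2 / v + - (Im z - Im m)\<^sup>2 / v) / (pi * v)"
    using assms by (subst exp_add) (simp add: abs_of_pos)
  also have "- (Re z - Re m)\<^sup>2 / v + - (Im z - Im m)\<^sup>2 / v = - (norm (z - m))\<^sup>2 / v"
    by (simp add: cmod_power2 diff_divide_distrib)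
  finally show ?thesis by (simp add: complex_normal_density_def)
qed

text \<open>Real and imaginary parts separate, and Tonelli leaves the total masses of two real
  Gaussian densities. This is the normalisation of the auxiliary density q(.|y), written as a ratio
  against p so that it is an integral with respect to the input law itself.\<close>

lemma nn_integral_complex_normal_density_ratio:
  assumes "0 < v" "0 < e"
  shows "(\<integral>\<^sup>+z. ennreal (complex_normal_density m e z / complex_normal_density 0 v z)
            \<partial>complex_normal v) = 1"
proof -
  let ?N = "real_normal (v / 2)"
  let ?r = "\<lambda>m x. normal_density m (sqrt (e / 2)) x / normal_density 0 (sqrt (v / 2)) x"
  interpret a: prob_space ?N by (rule prob_space_real_normal)
  interpret pair_prob_space ?N ?N ..
  have "(\<integral>\<^sup>+z. ennreal (complex_normal_density m e z / complex_normal_density 0 v z)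
      \<partial>complex_normal v) =
    (\<integral>\<^sup>+z. ennreal (case z of (x, y) \<Rightarrow>
        complex_normal_density m e (Complex x y) / complex_normal_density 0 v (Complex x y))
      \<partial>(?N \<Otimes>\<^sub>M ?N))"
    unfolding complex_normal_def by (subst nn_integral_distr) (auto simp: case_prod_beta)
  also have "\<dots> = (\<integral>\<^sup>+z. ennreal (?r (Re m) (fst z)) * ennreal (?r (Im m) (snd z)) \<partial>(?N \<Otimes>\<^sub>M ?N))"
    by (intro nn_integral_cong) 
      (auto simp: complex_normal_density_eq assms simp flip: ennreal_mult)
  also have "\<dots> = (\<integral>\<^sup>+x. \<integral>\<^sup>+y. ennreal (?r (Re m) x) * ennreal (?r (Im m) y) \<partial>?N \<partial>?N)"
    by (subst a.nn_integral_fst[symmetric]) auto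
  also have "\<dots> = 1"
    using assms by (simp add: nn_integral_cmult nn_integral_normal_density_ratio)
  finally show ?thesis .
qed

text \<open>The power computations use only the mean and the second moment of a source, so arbitrary
  signal laws and Gaussian distortions are treated alike. Square integrability makes the mean a
  genuine integral and not the default value 0.\<close>

definition centred_law :: "complex measure \<Rightarrow> real \<Rightarrow> bool" where
  "centred_law N c \<longleftrightarrow> prob_space N \<and> sets N = sets borel \<and>
     integrable N (\<lambda>z. (norm z)\<^sup>2) \<and> (LINT z|N. z) = 0 \<and> (LINT z|N. (norm z)\<^sup>2) = c"

lemma (in finite_measure) integrable_of_square_norm:
  fixes X :: "'a \<Rightarrow> 'b::{banach, second_countable_topology}"
  assumes "X \<in> borel_measurable M" "integrable M (\<lambda>x. (norm (X x))\<^sup>2)"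
  shows "integrable M X"
proof (rule Bochner_Integration.integrable_bound)
  show "integrable M (\<lambda>x. 1 + (norm (X x))\<^sup>2)" using assms by simp
  have "norm (X x) \<le> 1 + (norm (X x))\<^sup>2" for x
  proof -
    have "2 * norm (X x) \<le> 1 + (norm (X x))\<^sup>2"
      using zero_le_power2[of "norm (X x) - 1"] by (simp add: power2_diff)
    then show ?thesis using norm_ge_zero[of "X x"] by linarith
  qed
  then show "AE x in M. norm (X x) \<le> norm (1 + (norm (X x))\<^sup>2)" by simp
qed fact

lemma norm_add_square_complex:
  fixes w z :: complex
  shows "(norm (w + z))\<^sup>2 = (norm w)\<^sup>2 + 2 * Re (cnj w * z) + (norm z)\<^sup>2"
  unfolding cmod_power2 by (simp add: power2_eq_square algebra_simps)

text \<open>The cross term is twice the real part of \<open>cnj w\<close> times the mean, hence 0.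
  The nonnegative integral allows the identity to be used inside an outer integral whose finiteness
  is not yet known.\<close>

lemma centred_law_nn_integral_add:
  assumes "centred_law N c"
  shows "(\<integral>\<^sup>+z. ennreal ((norm (w + z))\<^sup>2) \<partial>N) = ennreal ((norm w)\<^sup>2) + ennreal c"
proof -
  interpret prob_space N using assms by (simp add: centred_law_def)
  have [simp, measurable_cong]: "sets N = sets borel"
    and sq: "integrable N (\<lambda>z. (norm z)\<^sup>2)" and z: "(LINT z|N. z) = 0"
    and c: "(LINT z|N. (norm z)\<^sup>2) = c"
    using assms by (auto simp: centred_law_def)
  have int: "integrable N (\<lambda>z. z)" by (rule integrable_of_square_norm) (use sq in auto)
  have "0 \<le> c" unfolding c[symmetric] by simp
  define h where "h = (\<lambda>z. cnj w * z)"
  have h: "integrable N h" "(LINT z|N. h z) = 0"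
    using int z by (simp_all add: h_def)
  have eq: "(norm (w + z))\<^sup>2 = (norm w)\<^sup>2 + 2 * Re (h z) + (norm z)\<^sup>2" for z
    unfolding h_def by (rule norm_add_square_complex)
  have "integrable N (\<lambda>z. (norm (w + z))\<^sup>2)"
    unfolding eq using h(1) sq by (intro Bochner_Integration.integrable_add) auto
  then have "(\<integral>\<^sup>+z. ennreal ((norm (w + z))\<^sup>2) \<partial>N) = ennreal (LINT z|N. (norm (w + z))\<^sup>2)"
    by (intro nn_integral_eq_integral) auto
  also have "(LINT z|N. (norm (w + z))\<^sup>2) = (norm w)\<^sup>2 + c"
    unfolding eq using h sq by (simp add: c prob_space)
  finally show ?thesis using \<open>0 \<le> c\<close> by simp
qed

lemma centred_law_nonneg: "centred_law N c \<Longrightarrow> 0 \<le> c"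
  by (auto simp: centred_law_def)

lemma centred_law_distr:
  assumes "prob_space N" and [measurable]: "f \<in> borel_measurable N"
    and "integrable N (\<lambda>x. (norm (f x))\<^sup>2)" "(LINT x|N. f x) = 0" "(LINT x|N. (norm (f x))\<^sup>2) = c"
  shows "centred_law (distr N borel f) c"
proof -
  have "(LINT z|distr N borel f. z) = (LINT x|N. f x)"
    "(LINT z|distr N borel f. (norm z)\<^sup>2) = (LINT x|N. (norm (f x))\<^sup>2)"
    by (rule integral_distr; measurable)+
  moreover have "integrable (distr N borel f) (\<lambda>z. (norm z)\<^sup>2)"
    by (subst integrable_distr_eq) (use assms in measurable)
  ultimately show ?thesis
    using assms by (auto simp: centred_law_def intro!: prob_space.prob_space_distr)
qed

lemma centred_law_scale:
  assumes "centred_law N c"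
  shows "centred_law (distr N borel (\<lambda>z. z * a)) (c * (norm a)\<^sup>2)"
proof -
  interpret prob_space N using assms by (simp add: centred_law_def)
  have [simp, measurable_cong]: "sets N = sets borel" using assms by (simp add: centred_law_def)
  have "integrable N (\<lambda>z. z)"
    by (rule integrable_of_square_norm) (use assms in \<open>auto simp: centred_law_def\<close>)
  then have "(LINT z|N. z * a) = 0"
    using assms by (simp add: centred_law_def)
  moreover have "(LINT z|N. (norm (z * a))\<^sup>2) = c * (norm a)\<^sup>2"
    "integrable N (\<lambda>z. (norm (z * a))\<^sup>2)"
    using assms by (simp_all add: centred_law_def norm_mult power_mult_distrib)
  ultimately show ?thesis
    by (intro centred_law_distr prob_space_axioms) simp_all
qed

text \<open>Variance 0 is included because powers, distortion levels and quadratic forms of singular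
  covariances may vanish. Both moments are read off the two marginals of the product.\<close>

lemma centred_law_complex_normal:
  assumes "0 \<le> v"
  shows "centred_law (complex_normal v) v"
proof -
  let ?N = "real_normal (v / 2)"
  interpret a: prob_space ?N by (rule prob_space_real_normal)
  interpret pair_prob_space ?N ?N ..
  note m = real_normal_moments[of "v / 2"]
  have i1: "integrable ?N (\<lambda>x. x)" "integrable ?N (\<lambda>x. x\<^sup>2)"
    and e1: "(LINT x|?N. x) = 0" "(LINT x|?N. x\<^sup>2) = v / 2"
    using m assms by (auto simp: has_bochner_integral_iff)
  have f: "distr (?N \<Otimes>\<^sub>M ?N) ?N fst = ?N" by (rule a.distr_pair_fst)
  \<comment> \<open>The second marginal follows from the first by swapping the two equal
    factors.\<close>
  have "distr (?N \<Otimes>\<^sub>M ?N) ?N fst = distr (distr (?N \<Otimes>\<^sub>M ?N) (?N \<Otimes>\<^sub>M ?N) (\<lambda>(x, y). (y, x))) ?N fst"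
    by (subst distr_pair_swap) simp
  also have "\<dots> = distr (?N \<Otimes>\<^sub>M ?N) ?N snd"
    by (subst distr_distr) (auto intro!: distr_cong)
  finally have g: "distr (?N \<Otimes>\<^sub>M ?N) ?N snd = ?N" by (simp add: f)
  have int: "integrable (?N \<Otimes>\<^sub>M ?N) (\<lambda>z. h (fst z))" "integrable (?N \<Otimes>\<^sub>M ?N) (\<lambda>z. h (snd z))"
    if "integrable ?N h" for h :: "real \<Rightarrow> real"
    using that by (auto intro!: integrable_distr[of fst _ ?N h] integrable_distr[of snd _ ?N h] simp: f g)
  have exp: "(LINT z|(?N \<Otimes>\<^sub>M ?N). h (fst z)) = (LINT x|?N. h x)"
     "(LINT z|(?N \<Otimes>\<^sub>M ?N). h (snd z)) = (LINT x|?N. h x)"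
    if [measurable]: "h \<in> borel_measurable borel" for h :: "real \<Rightarrow> real"
    using integral_distr[of fst "?N \<Otimes>\<^sub>M ?N" ?N h] integral_distr[of snd "?N \<Otimes>\<^sub>M ?N" ?N h]
    by (simp_all add: f g)
  have C: "Complex (fst z) (snd z) = complex_of_real (fst z) + \<i> * complex_of_real (snd z)" for z
    by (simp add: complex_eq_iff)
  have ci: "integrable (?N \<Otimes>\<^sub>M ?N) (\<lambda>z. complex_of_real (fst z))"
     "integrable (?N \<Otimes>\<^sub>M ?N) (\<lambda>z. \<i> * complex_of_real (snd z))"
    using int[OF i1(1)] by (auto intro!: integrable_of_real)
  have "(LINT z|(?N \<Otimes>\<^sub>M ?N). Complex (fst z) (snd z)) = 0"
    unfolding C using ci exp[of "\<lambda>x. x"] e1(1)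
    by (subst Bochner_Integration.integral_add) simp_all
  moreover have "integrable (?N \<Otimes>\<^sub>M ?N) (\<lambda>z. (norm (Complex (fst z) (snd z)))\<^sup>2)"
    unfolding cmod_power2 using int[OF i1(2)] by simp
  moreover have "(LINT z|(?N \<Otimes>\<^sub>M ?N). (norm (Complex (fst z) (snd z)))\<^sup>2) = v"
    unfolding cmod_power2 using int[OF i1(2)] exp[of "\<lambda>x. x\<^sup>2"] e1(2) by simp
  ultimately show ?thesis
    unfolding complex_normal_def case_prod_beta'
    by (intro centred_law_distr prob_space_axioms) simp_all
qed

section \<open>Mutual information with a Gaussian input\<close>

text \<open>A form of Gibbs' inequality. With d the density of N with respect to M, log r - log d is
  at most (r/d - 1) / ln b, and the N-mean of r/d is at most the M-integral of r, hence at most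
  1.\<close>

lemma (in prob_space) KL_divergence_ge_integral_log:
  assumes b: "1 < b" and "prob_space N" and sets: "sets N = sets M"
    and ac: "absolutely_continuous M N" and ed: "integrable N (entropy_density b M N)"
    and r[measurable]: "r \<in> borel_measurable M" and pos: "\<And>x. 0 < r x"
    and le: "(\<integral>\<^sup>+x. ennreal (r x) \<partial>M) \<le> 1" and int: "integrable N (\<lambda>x. log b (r x))"
  shows "(LINT x|N. log b (r x)) \<le> KL_divergence b M N"
proof -
  interpret N: prob_space N by fact
  define D where "D = RN_deriv M N"
  define d where "d x = enn2real (D x)" for x
  have D[measurable]: "D \<in> borel_measurable M" by (simp add: D_def)
  have d[measurable]: "d \<in> borel_measurable M" by (simp add: d_def[abs_def])
  have N: "density M D = N" unfolding D_def by (rule density_RN_deriv[OF ac sets])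
  have fin: "AE x in M. D x \<noteq> \<infinity>"
    unfolding D_def by (rule RN_deriv_finite[OF N.sigma_finite_measure_axioms ac sets])
  \<comment> \<open>The zero set of the density is N-null, so dividing by d is harmless under
    N.\<close>
  have "AE x in N. 0 < D x \<and> D x \<noteq> \<infinity>"
    by (subst N[symmetric], subst AE_density) (use fin in auto)
  then have dpos: "AE x in N. 0 < d x"
    by eventually_elim (auto simp: d_def enn2real_positive_iff top.not_eq_extremum)
  have [measurable]: "r \<in> borel_measurable N" "d \<in> borel_measurable N"
    using r d measurable_cong_sets[OF sets refl] by blast+
  have "(\<integral>\<^sup>+x. ennreal (r x / d x) \<partial>N) = (\<integral>\<^sup>+x. D x * ennreal (r x / d x) \<partial>M)"
    by (subst N[symmetric], subst nn_integral_density) auto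
  \<comment> \<open>Only an inequality: the mass that r puts on the zero set of D is lost in the
    change of measure.\<close>
  also have "\<dots> \<le> (\<integral>\<^sup>+x. ennreal (r x) \<partial>M)"
  proof (rule nn_integral_mono_AE)
    show "AE x in M. D x * ennreal (r x / d x) \<le> ennreal (r x)"
      using fin
    proof eventually_elim
      case (elim x)
      then have "D x = ennreal (d x)" by (simp add: d_def top.not_eq_extremum)
      moreover have "0 \<le> d x" by (simp add: d_def)
      ultimately show ?case
        using pos[of x] by (cases "d x = 0") (simp_all flip: ennreal_mult)
    qed
  qed
  finally have le1: "(\<integral>\<^sup>+x. ennreal (r x / d x) \<partial>N) \<le> 1" using le by simp
  have nn: "0 \<le> r x / d x" for x using pos[of x] by (simp add: d_def)
  have int1: "integrable N (\<lambda>x. r x / d x)"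
    using le1 nn by (intro integrableI_nonneg) (auto intro: le_less_trans)
  have le2: "(LINT x|N. r x / d x) \<le> 1"
    using le1 nn_integral_eq_integral[OF int1] nn by simp
  have "(LINT x|N. log b (r x)) - KL_divergence b M N =
      (LINT x|N. log b (r x) - entropy_density b M N x)"
    using int ed by (simp add: KL_divergence_def)
  also have "\<dots> \<le> (LINT x|N. (r x / d x - 1) / ln b)"
  proof (rule integral_mono_AE)
    show "AE x in N. log b (r x) - entropy_density b M N x \<le> (r x / d x - 1) / ln b"
      using dpos
    proof eventually_elim
      case (elim x)
      have "ln (r x) - ln (d x) = ln (r x / d x)" using elim pos[of x] by (simp add: ln_div)
      also have "\<dots> \<le> r x / d x - 1" using elim pos[of x] by (intro ln_le_minus_one) simp
      finally show ?case
        using b by (simp add: entropy_density_def log_def D_def d_def divide_right_mono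
          flip: diff_divide_distrib)
    qed
  qed (use int ed int1 in auto)
  also have "\<dots> \<le> 0"
    using int1 le2 b by (simp add: N.prob_space divide_nonpos_pos)
  finally show ?thesis by simp
qed

text \<open>The Barber--Agakov bound: \<open>r(x, y)\<close> plays the role of \<open>q(x | y) / p(x)\<close> for an arbitrary
  auxiliary conditional density \<open>q\<close>.\<close>

lemma mutual_info_ge_integral_log:
  assumes "prob_space M" and X[measurable]: "X \<in> borel_measurable M" and Y[measurable]: "Y \<in> borel_measurable M"
    and r[measurable]: "r \<in> borel_measurable (borel \<Otimes>\<^sub>M borel)" and pos: "\<And>z. 0 < r z"
    and le: "\<And>y. (\<integral>\<^sup>+x. ennreal (r (x, y)) \<partial>distr M borel X) \<le> 1"
    and int: "integrable M (\<lambda>\<omega>. log 2 (r (X \<omega>, Y \<omega>)))"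
  shows "ereal (LINT \<omega>|M. log 2 (r (X \<omega>, Y \<omega>))) \<le> mutual_info M X Y"
proof -
  interpret prob_space M by fact
  interpret X: prob_space "distr M borel X" by (rule prob_space_distr) fact
  interpret Y: prob_space "distr M borel Y" by (rule prob_space_distr) fact
  interpret Q: pair_prob_space "distr M borel X" "distr M borel Y" ..
  let ?Q = "distr M borel X \<Otimes>\<^sub>M distr M borel Y"
  let ?J = "distr M (borel \<Otimes>\<^sub>M borel) (\<lambda>\<omega>. (X \<omega>, Y \<omega>))"
  have sQ: "sets ?Q = sets (borel \<Otimes>\<^sub>M borel)" by (intro sets_pair_measure_cong) auto
  have rQ[measurable]: "r \<in> borel_measurable ?Q"
    using r measurable_cong_sets[OF sQ refl] by blast
  have "(\<integral>\<^sup>+z. ennreal (r z) \<partial>?Q) =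
      (\<integral>\<^sup>+y. \<integral>\<^sup>+x. ennreal (r (x, y)) \<partial>distr M borel X \<partial>distr M borel Y)"
    by (subst Q.nn_integral_snd[symmetric]) auto
  also have "\<dots> \<le> (\<integral>\<^sup>+y. 1 \<partial>distr M borel Y)" by (intro nn_integral_mono le)
  also have "\<dots> = 1" by (simp add: Y.emeasure_space_1[simplified])
  finally have le1: "(\<integral>\<^sup>+z. ennreal (r z) \<partial>?Q) \<le> 1" .
  have "(LINT \<omega>|M. log 2 (r (X \<omega>, Y \<omega>))) = (LINT z|?J. log 2 (r z))"
    by (subst integral_distr) auto
  \<comment> \<open>Outside these two conditions \<open>mutual_info\<close> is infinite and the
    bound is trivial.\<close>
  moreover have "(LINT z|?J. log 2 (r z)) \<le> KL_divergence 2 ?Q ?J"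
    if "absolutely_continuous ?Q ?J" "integrable ?J (entropy_density 2 ?Q ?J)"
  proof (rule Q.KL_divergence_ge_integral_log)
    show "integrable ?J (\<lambda>z. log 2 (r z))" using int by (subst integrable_distr_eq) auto
    show "prob_space ?J" by (rule prob_space_distr) simp
  qed (use that le1 pos sQ in auto)
  ultimately show ?thesis by (simp add: mutual_info_def mutual_information_def Let_def)
qed

text \<open>The constant ratio 1 is admissible in the preceding bound, and its logarithm is
  0.\<close>

lemma mutual_info_nonneg:
  assumes "prob_space M" "X \<in> borel_measurable M" "Y \<in> borel_measurable M"
  shows "0 \<le> mutual_info M X Y"
proof -
  interpret X: prob_space "distr M borel X" using assms by (intro prob_space.prob_space_distr)
  show ?thesis
    using mutual_info_ge_integral_log[OF assms, of "\<lambda>_. 1"] X.emeasure_space_1 by (simp add: zero_ereal_def)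
qed

section \<open>Second moments and the bound for a scalar channel with random gain\<close>

lemma (in prob_space) complex_variance_eq:
  fixes g :: "'a \<Rightarrow> complex"
  assumes [measurable]: "g \<in> borel_measurable M" and sq: "integrable M (\<lambda>x. (norm (g x))\<^sup>2)"
  shows "complex_variance M g = (LINT x|M. (norm (g x))\<^sup>2) - (norm (LINT x|M. g x))\<^sup>2"
proof -
  define m where "m = (LINT x|M. g x)"
  have int: "integrable M g" by (rule integrable_of_square_norm) fact+
  have eq: "(norm (g x - m))\<^sup>2 = (norm (g x))\<^sup>2 - 2 * Re (cnj m * g x) + (norm m)\<^sup>2" for x
    unfolding cmod_power2 by (simp add: power2_eq_square algebra_simps)
  define h where "h = (\<lambda>x. cnj m * g x)"
  have h: "integrable M h" "(LINT x|M. h x) = cnj m * m"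
    using int by (auto simp: h_def m_def)
  have "complex_variance M g = (LINT x|M. (norm (g x))\<^sup>2 - 2 * Re (h x) + (norm m)\<^sup>2)"
    unfolding complex_variance_def m_def[symmetric] h_def eq ..
  also have "\<dots> = (LINT x|M. (norm (g x))\<^sup>2) - 2 * Re (LINT x|M. h x) + (norm m)\<^sup>2"
    using h(1) sq by (simp add: prob_space)
  also have "Re (LINT x|M. h x) = (norm m)\<^sup>2"
    unfolding h(2) cmod_power2 by (simp add: power2_eq_square)
  finally show ?thesis by (simp add: m_def)
qed

text \<open>The receiver knows only the mean of g: the fluctuation x (g - E g) counts as noise
  together with Z, and I is the power of this effective noise. The product measure makes x
  independent of the pair (g, Z), however g and Z depend on each other, so all cross terms with x
  vanish.\<close>

lemma mutual_info_gaussian_input: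
  fixes g Z :: "'w \<Rightarrow> complex"
  assumes "prob_space M" and [measurable]: "g \<in> borel_measurable M" "Z \<in> borel_measurable M"
    and g2: "integrable M (\<lambda>\<omega>. (norm (g \<omega>))\<^sup>2)" and Z2: "integrable M (\<lambda>\<omega>. (norm (Z \<omega>))\<^sup>2)"
    and p: "0 \<le> p"
  defines "S \<equiv> p * (norm (LINT \<omega>|M. g \<omega>))\<^sup>2"
    and "I \<equiv> p * complex_variance M g + (LINT \<omega>|M. (norm (Z \<omega>))\<^sup>2)"
  shows "ereal (log 2 (1 + S / I)) \<le>
    mutual_info (complex_normal p \<Otimes>\<^sub>M M) fst (\<lambda>(x, \<omega>). x * g \<omega> + Z \<omega>)"
proof -
  let ?P = "complex_normal p"
  let ?Y = "\<lambda>(x, \<omega>). x * g \<omega> + Z \<omega>"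
  interpret prob_space M by fact
  interpret P: prob_space ?P by (rule prob_space_complex_normal)
  interpret L: pair_prob_space ?P M ..
  have Y[measurable]: "?Y \<in> borel_measurable (?P \<Otimes>\<^sub>M M)" by measurable
  have "0 \<le> I" using p by (simp add: I_def complex_variance_def)
  show ?thesis
  proof (cases "p = 0 \<or> I = 0")
    case True
    then have "log 2 (1 + S / I) = 0" by (auto simp: S_def)
    then show ?thesis
      using mutual_info_nonneg[OF L.prob_space_axioms _ Y, of fst] by (simp add: zero_ereal_def)
  next
    case False
    then have "0 < p" "0 < I" using p \<open>0 \<le> I\<close> by auto
    have "0 \<le> S" using p by (simp add: S_def)
    define m where "m = (LINT \<omega>|M. g \<omega>)"
    \<comment> \<open>The linear MMSE coefficient E(x cnj Y) / E|Y|^2: the numerator is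
      \<open>p * cnj m\<close> and the denominator is \<open>S + I\<close>. The resulting mean
      square error is p - p S / (S + I), which is the value \<open>e\<close> below.\<close>
    define \<alpha> where "\<alpha> = complex_of_real (p / (S + I)) * cnj m"
    define e where "e = p * I / (S + I)"
    define r where "r z = complex_normal_density (\<alpha> * snd z) e (fst z) / complex_normal_density 0 p (fst z)" for z
    have "0 < e" using \<open>0 < p\<close> \<open>0 < I\<close> \<open>0 \<le> S\<close> by (simp add: e_def)
    have r[measurable]: "r \<in> borel_measurable (borel \<Otimes>\<^sub>M borel)"
      unfolding r_def[abs_def] by measurable
    have rpos: "0 < r z" for z
      using \<open>0 < p\<close> \<open>0 < e\<close> by (simp add: r_def complex_normal_density_pos)
    have P: "distr (?P \<Otimes>\<^sub>M M) borel fst = ?P"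
      using distr_pair_fst[of ?P] by (simp cong: distr_cong)
    have x2: "integrable (?P \<Otimes>\<^sub>M M) (\<lambda>z. (norm (fst z))\<^sup>2)" "(LINT z|(?P \<Otimes>\<^sub>M M). (norm (fst z))\<^sup>2) = p"
    proof -
      have *: "integrable ?P (\<lambda>x. (norm x)\<^sup>2)" "(LINT x|?P. (norm x)\<^sup>2) = p"
        using centred_law_complex_normal[OF p] by (simp_all add: centred_law_def)
      show "integrable (?P \<Otimes>\<^sub>M M) (\<lambda>z. (norm (fst z))\<^sup>2)"
        using *(1) by (subst (asm) P[symmetric], subst (asm) integrable_distr_eq) auto
      show "(LINT z|(?P \<Otimes>\<^sub>M M). (norm (fst z))\<^sup>2) = p"
        using *(2) by (subst (asm) P[symmetric], subst (asm) integral_distr) auto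
    qed
    have int_g: "integrable M g" by (rule integrable_of_square_norm) fact+
    \<comment> \<open>Chosen so that the estimation error is x - \<alpha> Y = x (1 + h) - \<alpha>
      Z.\<close>
    define h where "h = (\<lambda>\<omega>. - \<alpha> * g \<omega>)"
    have h: "integrable M h" "(LINT \<omega>|M. h \<omega>) = - \<alpha> * m" using int_g by (auto simp: h_def m_def)
    have h2: "integrable M (\<lambda>\<omega>. (norm (h \<omega>))\<^sup>2)"
      "(LINT \<omega>|M. (norm (h \<omega>))\<^sup>2) = (norm \<alpha>)\<^sup>2 * (LINT \<omega>|M. (norm (g \<omega>))\<^sup>2)"
      using g2 by (simp_all add: h_def norm_mult power_mult_distrib)
    have eq: "(norm (1 + h \<omega>))\<^sup>2 = 1 + 2 * Re (h \<omega>) + (norm (h \<omega>))\<^sup>2" for \<omega>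
      using norm_add_square_complex[of 1 "h \<omega>"] by simp
    have int_1h: "integrable M (\<lambda>\<omega>. (norm (1 + h \<omega>))\<^sup>2)"
      unfolding eq using h(1) h2 by (intro Bochner_Integration.integrable_add) auto
    have "(LINT \<omega>|M. (norm (1 + h \<omega>))\<^sup>2) = 1 + 2 * Re (LINT \<omega>|M. h \<omega>) + (LINT \<omega>|M. (norm (h \<omega>))\<^sup>2)"
      unfolding eq using h(1) h2(1) by (simp add: prob_space)
    also have "Re (LINT \<omega>|M. h \<omega>) = - S / (S + I)"
    proof -
      have "\<alpha> * m = complex_of_real (p / (S + I) * (norm m)\<^sup>2)"
        unfolding \<alpha>_def of_real_mult complex_norm_square by simp
      then show ?thesis unfolding h(2) by (simp add: S_def m_def)
    qed
    also note h2(2)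
    also have "(LINT \<omega>|M. (norm (g \<omega>))\<^sup>2) = complex_variance M g + (norm m)\<^sup>2"
      using complex_variance_eq[of g] g2 by (simp add: m_def)
    finally have E1h: "(LINT \<omega>|M. (norm (1 + h \<omega>))\<^sup>2) =
      1 - 2 * S / (S + I) + (norm \<alpha>)\<^sup>2 * (complex_variance M g + (norm m)\<^sup>2)"
      by simp
    have \<alpha>2: "(norm \<alpha>)\<^sup>2 = p * S / (S + I)\<^sup>2"
      unfolding \<alpha>_def norm_mult norm_of_real S_def m_def
      by (simp add: power_mult_distrib power_divide power2_eq_square)
    have "(\<integral>\<^sup>+z. ennreal ((norm (fst z - \<alpha> * ?Y z))\<^sup>2) \<partial>(?P \<Otimes>\<^sub>M M)) =
       (\<integral>\<^sup>+\<omega>. \<integral>\<^sup>+x. ennreal ((norm (- (\<alpha> * Z \<omega>) + x * (1 + h \<omega>)))\<^sup>2) \<partial>?P \<partial>M)"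
      by (subst L.nn_integral_snd[symmetric])
        (auto simp: h_def algebra_simps)
    also have "\<dots> = (\<integral>\<^sup>+\<omega>. ennreal ((norm (\<alpha> * Z \<omega>))\<^sup>2) + ennreal (p * (norm (1 + h \<omega>))\<^sup>2) \<partial>M)"
    proof (intro nn_integral_cong)
      \<comment> \<open>With \<omega> frozen, x (1 + h) has a centred law of power p |1 + h|^2 and -
        \<alpha> Z is a constant shift, so the squares add.\<close>
      fix \<omega>
      have "(\<integral>\<^sup>+x. ennreal ((norm (- (\<alpha> * Z \<omega>) + x * (1 + h \<omega>)))\<^sup>2) \<partial>?P) =
          (\<integral>\<^sup>+x. ennreal ((norm (- (\<alpha> * Z \<omega>) + x))\<^sup>2) \<partial>distr ?P borel (\<lambda>x. x * (1 + h \<omega>)))"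
        by (subst nn_integral_distr) auto
      then show "(\<integral>\<^sup>+x. ennreal ((norm (- (\<alpha> * Z \<omega>) + x * (1 + h \<omega>)))\<^sup>2) \<partial>?P) =
          ennreal ((norm (\<alpha> * Z \<omega>))\<^sup>2) + ennreal (p * (norm (1 + h \<omega>))\<^sup>2)"
        using centred_law_nn_integral_add[OF centred_law_scale[OF centred_law_complex_normal[OF p]],
            where w = "- (\<alpha> * Z \<omega>)"]
        by simp
    qed
    also have "\<dots> = (\<integral>\<^sup>+\<omega>. ennreal ((norm \<alpha>)\<^sup>2 * (norm (Z \<omega>))\<^sup>2 + p * (norm (1 + h \<omega>))\<^sup>2) \<partial>M)"
      using p by (intro nn_integral_cong) (simp add: norm_mult power_mult_distrib)
    also have "\<dots> = ennreal (LINT \<omega>|M. (norm \<alpha>)\<^sup>2 * (norm (Z \<omega>))\<^sup>2 + p * (norm (1 + h \<omega>))\<^sup>2)"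
      using p Z2 int_1h by (intro nn_integral_eq_integral) auto
    also have "(LINT \<omega>|M. (norm \<alpha>)\<^sup>2 * (norm (Z \<omega>))\<^sup>2 + p * (norm (1 + h \<omega>))\<^sup>2) =
       (norm \<alpha>)\<^sup>2 * (LINT \<omega>|M. (norm (Z \<omega>))\<^sup>2) + p * (LINT \<omega>|M. (norm (1 + h \<omega>))\<^sup>2)"
      using Z2 int_1h by simp
    also have "\<dots> = p * (1 - 2 * S / (S + I)) + (norm \<alpha>)\<^sup>2 * (S + I)"
      unfolding E1h by (simp add: I_def S_def m_def algebra_simps)
    also have "\<dots> = e"
    proof -
      have "p * S / (S + I)\<^sup>2 * (S + I) = p * S / (S + I)" by (simp add: power2_eq_square)
      moreover have "p * (1 - 2 * S / (S + I)) + p * S / (S + I) = p * I / (S + I)"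
      proof -
        have "p * (1 - 2 * S / T) + p * S / T = p * (T - S) / T" if "T \<noteq> 0" for T
          using that by (simp add: field_simps)
        from this[of "S + I"] show ?thesis using \<open>0 < I\<close> \<open>0 \<le> S\<close> by simp
      qed
      ultimately show ?thesis unfolding \<alpha>2 e_def by metis
    qed
    finally have nn: "(\<integral>\<^sup>+z. ennreal ((norm (fst z - \<alpha> * ?Y z))\<^sup>2) \<partial>(?P \<Otimes>\<^sub>M M)) = ennreal e" .
    have mse: "has_bochner_integral (?P \<Otimes>\<^sub>M M) (\<lambda>z. (norm (fst z - \<alpha> * ?Y z))\<^sup>2) e"
      using nn \<open>0 < e\<close> by (intro has_bochner_integral_nn_integral) auto
    \<comment> \<open>The prefactors of the two Gaussian densities give \<open>ln (p / e)\<close>;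
      the exponents give the squared error and the squared input.\<close>
    have log_r: "log 2 (r (fst z, ?Y z)) =
        (ln (p / e) - (norm (fst z - \<alpha> * ?Y z))\<^sup>2 / e + (norm (fst z))\<^sup>2 / p) / ln 2" for z
      using \<open>0 < p\<close> \<open>0 < e\<close>
      by (simp add: r_def complex_normal_density_def log_def ln_div ln_mult)
    have int: "integrable (?P \<Otimes>\<^sub>M M) (\<lambda>z. log 2 (r (fst z, ?Y z)))"
      unfolding log_r using mse x2(1) by (auto simp: has_bochner_integral_iff)
    \<comment> \<open>The quadratic terms have means \<open>e / e\<close> and \<open>p / p\<close>,
      which cancel; this is where the variance of q equal to the mean square error pays off.\<close>
    have "(LINT z|(?P \<Otimes>\<^sub>M M). log 2 (r (fst z, ?Y z))) = (ln (p / e) - e / e + p / p) / ln 2"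
      unfolding log_r using mse x2 by (simp add: has_bochner_integral_iff L.prob_space)
    also have "\<dots> = log 2 (p / e)" using \<open>0 < p\<close> \<open>0 < e\<close> by (simp add: log_def)
    also have "p / e = 1 + S / I" using \<open>0 < p\<close> \<open>0 < I\<close> \<open>0 \<le> S\<close> by (simp add: e_def field_simps)
    finally have eq: "(LINT z|(?P \<Otimes>\<^sub>M M). log 2 (r (fst z, ?Y z))) = log 2 (1 + S / I)" .
    have "(\<integral>\<^sup>+x. ennreal (r (x, y)) \<partial>distr (?P \<Otimes>\<^sub>M M) borel fst) \<le> 1" for y
      unfolding P r_def using nn_integral_complex_normal_density_ratio[OF \<open>0 < p\<close> \<open>0 < e\<close>] by simp
    then show ?thesis
      using mutual_info_ge_integral_log[OF L.prob_space_axioms _ Y r rpos _ int] eq by simp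
  qed
qed

section \<open>Conditional kernels\<close>

text \<open>A regular conditional distribution of X given F. The second measure F serves only as a
  carrier of a sub-sigma-algebra: probabilities are always taken under M.\<close>

definition conditional_kernel ::
  "'w measure \<Rightarrow> 'w measure \<Rightarrow> 'b measure \<Rightarrow> ('w \<Rightarrow> 'b) \<Rightarrow> ('w \<Rightarrow> 'b measure) \<Rightarrow> bool" where
  "conditional_kernel M F N X \<kappa> \<longleftrightarrow> subalgebra M F \<and> X \<in> M \<rightarrow>\<^sub>M N \<and> \<kappa> \<in> F \<rightarrow>\<^sub>M prob_algebra N \<and>
     (\<forall>A\<in>sets F. \<forall>B\<in>sets N. emeasure M (A \<inter> X -` B) = (\<integral>\<^sup>+\<omega>\<in>A. emeasure (\<kappa> \<omega>) B \<partial>M))"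

text \<open>Under independence the constant kernel is a conditional distribution. This puts
  independent sources on the same footing as the receive distortion, whose kernel varies with the
  channels.\<close>

lemma (in prob_space) conditional_kernel_indep:
  assumes F: "subalgebra M F" and X: "X \<in> M \<rightarrow>\<^sub>M N"
    and indep: "\<And>A B. A \<in> sets F \<Longrightarrow> B \<in> sets N \<Longrightarrow>
      prob (A \<inter> (X -` B \<inter> space M)) = prob A * prob (X -` B \<inter> space M)"
  shows "conditional_kernel M F N X (\<lambda>_. distr M N X)"
proof -
  have "distr M N X \<in> space (prob_algebra N)"
    using prob_space_distr[OF X] by (simp add: space_prob_algebra)
  moreover have "emeasure M (A \<inter> X -` B) = (\<integral>\<^sup>+\<omega>\<in>A. emeasure (distr M N X) B \<partial>M)"
    if A: "A \<in> sets F" and B: "B \<in> sets N" for A B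
  proof -
    have AM: "A \<in> sets M" using A F by (auto simp: subalgebra_def)
    then have "A \<inter> X -` B = A \<inter> (X -` B \<inter> space M)" using sets.sets_into_space by blast
    then have "emeasure M (A \<inter> X -` B) = ennreal (prob A * prob (X -` B \<inter> space M))"
      using indep[OF A B] by (simp add: emeasure_eq_measure)
    also have "\<dots> = emeasure (distr M N X) B * emeasure M A"
      using X B by (simp add: emeasure_distr emeasure_eq_measure ennreal_mult mult.commute)
    also have "\<dots> = (\<integral>\<^sup>+\<omega>\<in>A. emeasure (distr M N X) B \<partial>M)"
      using AM by (simp add: nn_integral_cmult_indicator)
    finally show ?thesis .
  qed
  ultimately show ?thesis using F X by (simp add: conditional_kernel_def)
qed

text \<open>Disintegration of the joint law of the outcome, seen through F, and X. The defining
  equation of the kernel says that two probability measures on the product agree on rectangles,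
  which form an intersection-stable generator.\<close>

lemma (in prob_space) nn_integral_conditional_kernel:
  assumes K: "conditional_kernel M F N X \<kappa>" and f: "f \<in> borel_measurable (F \<Otimes>\<^sub>M N)"
  shows "(\<integral>\<^sup>+\<omega>. f (\<omega>, X \<omega>) \<partial>M) = (\<integral>\<^sup>+\<omega>. \<integral>\<^sup>+x. f (\<omega>, x) \<partial>\<kappa> \<omega> \<partial>M)"
proof -
  have F: "subalgebra M F" and X[measurable]: "X \<in> M \<rightarrow>\<^sub>M N" and "\<kappa> \<in> F \<rightarrow>\<^sub>M prob_algebra N"
    and eq: "\<And>A B. A \<in> sets F \<Longrightarrow> B \<in> sets N \<Longrightarrow>
       emeasure M (A \<inter> X -` B) = (\<integral>\<^sup>+\<omega>\<in>A. emeasure (\<kappa> \<omega>) B \<partial>M)"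
    using K by (auto simp: conditional_kernel_def)
  then have \<kappa>[measurable]: "\<kappa> \<in> F \<rightarrow>\<^sub>M subprob_algebra N"
    by (intro measurable_prob_algebraD)
  have sp: "space F = space M" using F by (simp add: subalgebra_def)
  have id[measurable]: "(\<lambda>\<omega>. \<omega>) \<in> M \<rightarrow>\<^sub>M F" using F by (auto simp: subalgebra_def measurable_def)
  define R where "R = restr_to_subalg M F"
  have sR[measurable_cong]: "sets R = sets F" and spR: "space R = space M"
    using F by (simp_all add: R_def sets_restr_to_subalg space_restr_to_subalg)
  have ne: "space R \<noteq> {}" using not_empty spR by simp
  \<comment> \<open>The kernel \<nu> attaches the point \<omega> to a draw from \<kappa> at
    \<omega>, so binding it to the restriction of M to F builds the candidate joint law.\<close>
  define \<nu> where "\<nu> \<omega> = distr (\<kappa> \<omega>) (F \<Otimes>\<^sub>M N) (Pair \<omega>)" for \<omega>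
  have \<nu>F: "\<nu> \<in> F \<rightarrow>\<^sub>M subprob_algebra (F \<Otimes>\<^sub>M N)"
    unfolding \<nu>_def[abs_def] by (rule measurable_distr2[OF _ \<kappa>]) simp
  then have \<nu>: "\<nu> \<in> R \<rightarrow>\<^sub>M subprob_algebra (F \<Otimes>\<^sub>M N)"
    using measurable_cong_sets[OF sR refl] by blast
  have nn: "(\<integral>\<^sup>+z. h z \<partial>\<nu> \<omega>) = (\<integral>\<^sup>+x. h (\<omega>, x) \<partial>\<kappa> \<omega>)"
    if \<omega>: "\<omega> \<in> space M" and h[measurable]: "h \<in> borel_measurable (F \<Otimes>\<^sub>M N)" for h \<omega>
  proof -
    have s[measurable_cong]: "sets (\<kappa> \<omega>) = sets N" using subprob_measurableD(2)[OF \<kappa>] \<omega> sp by simp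
    have "Pair \<omega> \<in> \<kappa> \<omega> \<rightarrow>\<^sub>M F \<Otimes>\<^sub>M N" 
      using \<omega> sp by (subst measurable_cong_sets[OF s refl], intro measurable_Pair1') simp
    then show ?thesis unfolding \<nu>_def by (subst nn_integral_distr) auto
  qed
  have bind_nn: "(\<integral>\<^sup>+z. h z \<partial>(R \<bind> \<nu>)) = (\<integral>\<^sup>+\<omega>. \<integral>\<^sup>+x. h (\<omega>, x) \<partial>\<kappa> \<omega> \<partial>M)"
    if h: "h \<in> borel_measurable (F \<Otimes>\<^sub>M N)" for h
  proof -
    have "(\<integral>\<^sup>+z. h z \<partial>(R \<bind> \<nu>)) = (\<integral>\<^sup>+\<omega>. \<integral>\<^sup>+z. h z \<partial>\<nu> \<omega> \<partial>R)"
      by (rule nn_integral_bind[OF h \<nu>])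
    also have "\<dots> = (\<integral>\<^sup>+\<omega>. \<integral>\<^sup>+z. h z \<partial>\<nu> \<omega> \<partial>M)"
      unfolding R_def 
      by (intro nn_integral_subalgebra2[OF F]
          measurable_compose[OF \<nu>F nn_integral_measurable_subprob_algebra[OF h]])
    also have "\<dots> = (\<integral>\<^sup>+\<omega>. \<integral>\<^sup>+x. h (\<omega>, x) \<partial>\<kappa> \<omega> \<partial>M)"
      using h by (intro nn_integral_cong) (simp add: nn)
    finally show ?thesis .
  qed
  have sB: "sets (R \<bind> \<nu>) = sets (F \<Otimes>\<^sub>M N)"
    by (rule sets_bind[OF subprob_measurableD(2)[OF \<nu>] ne])
  have "distr M (F \<Otimes>\<^sub>M N) (\<lambda>\<omega>. (\<omega>, X \<omega>)) = R \<bind> \<nu>"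
  proof (rule measure_eqI_generator_eq[OF Int_stable_pair_measure_generator[of F N]])
    show "{a \<times> b |a b. a \<in> sets F \<and> b \<in> sets N} \<subseteq> Pow (space F \<times> space N)"
      by (rule pair_measure_closed)
    show "sets (distr M (F \<Otimes>\<^sub>M N) (\<lambda>\<omega>. (\<omega>, X \<omega>))) =
        sigma_sets (space F \<times> space N) {a \<times> b |a b. a \<in> sets F \<and> b \<in> sets N}"
      by (simp add: sets_pair_measure)
    show "sets (R \<bind> \<nu>) = sigma_sets (space F \<times> space N) {a \<times> b |a b. a \<in> sets F \<and> b \<in> sets N}"
      by (simp add: sB sets_pair_measure)
    show "range (\<lambda>i::nat. space F \<times> space N) \<subseteq> {a \<times> b |a b. a \<in> sets F \<and> b \<in> sets N}" by auto
    show "(\<Union>i::nat. space F \<times> space N) = space F \<times> space N" by simp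
    show "emeasure (distr M (F \<Otimes>\<^sub>M N) (\<lambda>\<omega>. (\<omega>, X \<omega>))) (space F \<times> space N) \<noteq> \<infinity>"
      by (subst emeasure_distr) auto
    fix Z assume "Z \<in> {a \<times> b |a b. a \<in> sets F \<and> b \<in> sets N}"
    then obtain A B where Z: "Z = A \<times> B" and A[measurable]: "A \<in> sets F" and B[measurable]: "B \<in> sets N" by auto
    have AM: "A \<subseteq> space M" using sets.sets_into_space[OF A] sp by simp
    have "emeasure (distr M (F \<Otimes>\<^sub>M N) (\<lambda>\<omega>. (\<omega>, X \<omega>))) Z = emeasure M ((\<lambda>\<omega>. (\<omega>, X \<omega>)) -` Z \<inter> space M)"
      unfolding Z by (rule emeasure_distr) measurable
    also have "(\<lambda>\<omega>. (\<omega>, X \<omega>)) -` Z \<inter> space M = A \<inter> X -` B" using AM by (auto simp: Z)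
    also have "emeasure M (A \<inter> X -` B) = (\<integral>\<^sup>+\<omega>\<in>A. emeasure (\<kappa> \<omega>) B \<partial>M)" by (rule eq[OF A B])
    also have "\<dots> = (\<integral>\<^sup>+\<omega>. \<integral>\<^sup>+x. indicator Z (\<omega>, x) \<partial>\<kappa> \<omega> \<partial>M)"
    proof (intro nn_integral_cong)
      fix \<omega> assume "\<omega> \<in> space M"
      then have "sets (\<kappa> \<omega>) = sets N" using subprob_measurableD(2)[OF \<kappa>] sp by simp
      then show "emeasure (\<kappa> \<omega>) B * indicator A \<omega> = (\<integral>\<^sup>+x. indicator Z (\<omega>, x) \<partial>\<kappa> \<omega>)"
        unfolding Z indicator_times using B by (simp add: nn_integral_cmult_indicator mult.commute)
    qed
    also have "\<dots> = (\<integral>\<^sup>+z. indicator Z z \<partial>(R \<bind> \<nu>))" unfolding Z by (rule bind_nn[symmetric]) measurable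
    also have "\<dots> = emeasure (R \<bind> \<nu>) Z"
      unfolding Z by (intro nn_integral_indicator) (simp add: sB)
    finally show "emeasure (distr M (F \<Otimes>\<^sub>M N) (\<lambda>\<omega>. (\<omega>, X \<omega>))) Z = emeasure (R \<bind> \<nu>) Z" .
  qed
  moreover have "(\<integral>\<^sup>+\<omega>. f (\<omega>, X \<omega>) \<partial>M) = (\<integral>\<^sup>+z. f z \<partial>distr M (F \<Otimes>\<^sub>M N) (\<lambda>\<omega>. (\<omega>, X \<omega>)))"
    using f by (subst nn_integral_distr) auto
  ultimately show ?thesis using bind_nn[OF f] by simp
qed

text \<open>Working with nonnegative integrals of the shifted square avoids conditional expectations of
  products: the cross term vanishes inside the kernel.\<close>

lemma (in prob_space) nn_integral_add_conditionally_centred: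
  assumes K: "conditional_kernel M F N X \<kappa>"
    and W[measurable]: "W \<in> borel_measurable F" and \<phi>[measurable]: "\<phi> \<in> borel_measurable (F \<Otimes>\<^sub>M N)"
    and c: "\<And>\<omega>. \<omega> \<in> space M \<Longrightarrow> centred_law (distr (\<kappa> \<omega>) borel (\<lambda>x. \<phi> (\<omega>, x))) (c \<omega>)"
    and cm[measurable]: "c \<in> borel_measurable M"
  shows "(\<integral>\<^sup>+\<omega>. ennreal ((norm (W \<omega> + \<phi> (\<omega>, X \<omega>)))\<^sup>2) \<partial>M) =
    (\<integral>\<^sup>+\<omega>. ennreal ((norm (W \<omega>))\<^sup>2) \<partial>M) + (\<integral>\<^sup>+\<omega>. ennreal (c \<omega>) \<partial>M)"
proof -
  have F: "subalgebra M F" and "\<kappa> \<in> F \<rightarrow>\<^sub>M prob_algebra N"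
    using K by (auto simp: conditional_kernel_def)
  then have \<kappa>: "\<kappa> \<in> F \<rightarrow>\<^sub>M subprob_algebra N" by (intro measurable_prob_algebraD)
  have [measurable]: "W \<in> borel_measurable M" by (rule measurable_from_subalg[OF F W])
  have "(\<integral>\<^sup>+\<omega>. ennreal ((norm (W \<omega> + \<phi> (\<omega>, X \<omega>)))\<^sup>2) \<partial>M) =
     (\<integral>\<^sup>+\<omega>. \<integral>\<^sup>+x. ennreal ((norm (W \<omega> + \<phi> (\<omega>, x)))\<^sup>2) \<partial>\<kappa> \<omega> \<partial>M)"
    using nn_integral_conditional_kernel[OF K, of "\<lambda>z. ennreal ((norm (W (fst z) + \<phi> z))\<^sup>2)"] by simp
  also have "\<dots> = (\<integral>\<^sup>+\<omega>. ennreal ((norm (W \<omega>))\<^sup>2) + ennreal (c \<omega>) \<partial>M)"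
  proof (intro nn_integral_cong)
    fix \<omega> assume \<omega>: "\<omega> \<in> space M"
    then have \<omega>F: "\<omega> \<in> space F" using F by (simp add: subalgebra_def)
    have s: "sets (\<kappa> \<omega>) = sets N" using subprob_measurableD(2)[OF \<kappa> \<omega>F] .
    have "(\<lambda>x. \<phi> (\<omega>, x)) \<in> borel_measurable (\<kappa> \<omega>)"
      using \<omega>F
      by (subst measurable_cong_sets[OF s refl], intro measurable_compose[OF _ \<phi>] measurable_Pair1')
    then have "(\<integral>\<^sup>+x. ennreal ((norm (W \<omega> + \<phi> (\<omega>, x)))\<^sup>2) \<partial>\<kappa> \<omega>) =
       (\<integral>\<^sup>+z. ennreal ((norm (W \<omega> + z))\<^sup>2) \<partial>distr (\<kappa> \<omega>) borel (\<lambda>x. \<phi> (\<omega>, x)))"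
      by (subst nn_integral_distr) auto
    also have "\<dots> = ennreal ((norm (W \<omega>))\<^sup>2) + ennreal (c \<omega>)"
      by (rule centred_law_nn_integral_add[OF c[OF \<omega>]])
    finally show "(\<integral>\<^sup>+x. ennreal ((norm (W \<omega> + \<phi> (\<omega>, x)))\<^sup>2) \<partial>\<kappa> \<omega>) = \<dots>" .
  qed
  also have "\<dots> = (\<integral>\<^sup>+\<omega>. ennreal ((norm (W \<omega>))\<^sup>2) \<partial>M) + (\<integral>\<^sup>+\<omega>. ennreal (c \<omega>) \<partial>M)"
    by (rule nn_integral_add) auto
  finally show ?thesis .
qed

text \<open>The shift identity for all w forces the mean m to be 0, which therefore need not be
  computed separately: w = - m gives variance |m|^2 + c, while w = 0 gives c - |m|^2.\<close>

lemma (in prob_space) complex_variance_eqI: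
  assumes X[measurable]: "X \<in> borel_measurable M" and "0 \<le> c"
    and eq: "\<And>w. (\<integral>\<^sup>+\<omega>. ennreal ((norm (w + X \<omega>))\<^sup>2) \<partial>M) = ennreal ((norm w)\<^sup>2) + ennreal c"
  shows "complex_variance M X = c"
proof -
  have hbi: "has_bochner_integral M (\<lambda>\<omega>. (norm (w + X \<omega>))\<^sup>2) ((norm w)\<^sup>2 + c)" for w
    using eq[of w] \<open>0 \<le> c\<close> by (intro has_bochner_integral_nn_integral) auto
  define m where "m = (LINT \<omega>|M. X \<omega>)"
  have "complex_variance M X = (norm m)\<^sup>2 + c"
    using hbi[of "- m"] by (simp add: complex_variance_def m_def has_bochner_integral_iff)
  moreover have "complex_variance M X = c - (norm m)\<^sup>2"
    using complex_variance_eq[OF X] hbi[of 0] by (simp add: m_def has_bochner_integral_iff)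
  ultimately show ?thesis by simp
qed

section \<open>The uplink\<close>

lemma row_mult_add: "row_mult r (x + y) = row_mult r x + row_mult r y"
  by (simp add: row_mult_def distrib_left sum.distrib)

lemma row_mult_scale: "row_mult r (c *s x) = c * row_mult r x"
  by (simp add: row_mult_def sum_distrib_left mult.left_commute)

lemma row_mult_sum: "row_mult r (\<Sum>i\<in>I. f i) = (\<Sum>i\<in>I. row_mult r (f i))"
  by (induction I rule: infinite_finite_induct) (simp_all add: row_mult_add, simp_all add: row_mult_def)

lemma power2_norm_vec: "(norm (x :: complex ^ 'n))\<^sup>2 = (\<Sum>a\<in>UNIV. (norm (x $ a))\<^sup>2)"
  by (simp add: norm_vec_def L2_set_def sum_nonneg)

lemma eff_chan_nth:
  "eff_chan U i n \<omega> $ a = cis (ap_phase U a n \<omega> + ue_phase U i n \<omega>) * chan U i \<omega> $ a"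
  by (simp add: eff_chan_def phase_mat_def diag_mat_def matrix_vector_mult_def if_distrib[of "\<lambda>x. x * _"]
      cong: if_cong)

lemma comb_row_nth:
  "comb_row U k n \<omega> $ a = cnj (combiner U k n \<omega> $ a) * (if serves U (fst a) k then 1 else 0)"
proof -
  have "comb_row U k n \<omega> $ a =
      (\<Sum>b\<in>UNIV. if b = a then cnj (combiner U k n \<omega> $ a) * (if serves U (fst a) k then 1 else 0) else 0)"
    unfolding comb_row_def serve_mat_def diag_mat_def vector_matrix_mult_def vec_lambda_beta
    by (rule sum.cong) (auto split: prod.split)
  then show ?thesis by simp
qed

lemma serve_mat_combiner_nth:
  "(serve_mat U k *v combiner U k n \<omega>) $ a = cnj (comb_row U k n \<omega> $ a)"
proof -
  have "(serve_mat U k *v combiner U k n \<omega>) $ a =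
      (\<Sum>b\<in>UNIV. if b = a then (if serves U (fst a) k then 1 else 0) * combiner U k n \<omega> $ a else 0)"
    unfolding serve_mat_def diag_mat_def matrix_vector_mult_def vec_lambda_beta
    by (rule sum.cong) (auto split: prod.split)
  then show ?thesis by (simp add: comb_row_nth)
qed

lemma matrix_vector_mult_nth: "(A *v x) $ a = row_mult (A $ a) x"
  by (simp add: row_mult_def matrix_vector_mult_def)

text \<open>The serving mask and the combiner give the conjugate of the combining row on the right,
  so the expression is a Hermitian form of the receive covariance, as supplied by the conditional
  Gaussian law.\<close>

lemma rx_dist_form_eq:
  "rx_dist_form U k n \<omega> = herm_form (\<chi> a. cnj (comb_row U k n \<omega> $ a)) (rx_dist_cov U \<omega>)"
  by (simp add: rx_dist_form_def matrix_vector_mult_nth[of "rx_dist_cov U \<omega>"] row_mult_def herm_form_def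
      serve_mat_combiner_nth sum_distrib_left mult.assoc)

lemma herm_form_scalar:
  "herm_form (\<chi> a. cnj (r $ a)) (mat (complex_of_real c)) = complex_of_real (c * (norm r)\<^sup>2)"
proof -
  have "herm_form (\<chi> a. cnj (r $ a)) (mat (complex_of_real c)) =
      (\<Sum>a\<in>UNIV. \<Sum>b\<in>UNIV. if b = a then complex_of_real c * complex_of_real ((norm (r $ a))\<^sup>2) else 0)"
    unfolding herm_form_def mat_def complex_norm_square by (intro sum.cong) auto
  then show ?thesis by (simp add: power2_norm_vec sum_distrib_left)
qed

text \<open>Gaussian vectors are specified by functionals that conjugate their coefficients, whereas
  \<open>row_mult\<close> does not; hence the conjugated vector in the form.\<close>

lemma centred_law_row_mult:
  assumes "complex_normal_vec N A"
  shows "centred_law (distr N borel (row_mult r)) (Re (herm_form (\<chi> a. cnj (r $ a)) A))"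
proof -
  have "distr N borel (row_mult r) = complex_normal (Re (herm_form (\<chi> a. cnj (r $ a)) A))"
    using assms unfolding complex_normal_vec_def
    by (auto simp: row_mult_def[abs_def] dest!: conjunct2 spec[of _ "\<chi> a. cnj (r $ a)"])
  moreover have "0 \<le> Re (herm_form (\<chi> a. cnj (r $ a)) A)"
    using assms by (simp add: complex_normal_vec_def covariance_matrix_def)
  ultimately show ?thesis using centred_law_complex_normal by simp
qed

section \<open>Measurability and grouping of independent sources\<close>

lemma borel_measurable_vec_nth_complex[measurable (raw)]:
  "f \<in> borel_measurable M \<Longrightarrow> (\<lambda>x. (f x :: complex ^ 'n) $ a) \<in> borel_measurable M"
  by (rule measurable_compose[of f M borel "\<lambda>v. v $ a"])
     (auto intro!: borel_measurable_continuous_onI continuous_intros)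

lemma borel_measurable_cnj[measurable (raw)]:
  "f \<in> borel_measurable M \<Longrightarrow> (\<lambda>x. cnj (f x)) \<in> borel_measurable M"
  by (rule measurable_compose[of f M borel cnj])
     (auto intro!: borel_measurable_continuous_onI continuous_intros)

lemma borel_measurable_row_mult:
  assumes "\<And>a. (\<lambda>x. r x $ a) \<in> borel_measurable M" "\<And>a. (\<lambda>x. y x $ a) \<in> borel_measurable M"
  shows "(\<lambda>x. row_mult (r x) (y x)) \<in> borel_measurable M"
  unfolding row_mult_def using assms by measurable

text \<open>Disjoint blocks of an independent family generate independent sigma-algebras. The two
  blocks J and {x} are indexed by the Booleans.\<close>

lemma (in prob_space) indep_sets_prob_Int:
  assumes indep: "indep_sets E UNIV" and "\<And>i. Int_stable (E i)" and x: "x \<notin> J"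
    and A: "A \<in> sigma_sets (space M) (\<Union>i\<in>J. E i)" and B: "B \<in> E x"
  shows "prob (A \<inter> B) = prob A * prob B"
proof -
  define K where "K b = (if b then J else {x})" for b
  have "indep_sets (\<lambda>b. sigma_sets (space M) (\<Union>i\<in>K b. E i)) UNIV"
    using assms by (intro indep_sets_collect_sigma)
      (auto simp: K_def disjoint_family_on_def intro: indep_sets_mono_index[OF _ indep])
  from indep_setsD[OF this, of UNIV "case_bool A B"] A B
  show ?thesis by (simp add: K_def UNIV_bool Int_commute mult.commute sigma_sets.Basic split: bool.split)
qed

text \<open>The sigma-algebra generated by the sources in J, packaged as a measure so that
  measurability can be stated with respect to it.\<close>

definition known :: "('w, 'm::finite, 'l::finite, 'u::finite) uplink \<Rightarrow> nat \<Rightarrow> 'u source set \<Rightarrow> 'w measure" where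
  "known U n J = sigma (space (PS U)) (\<Union>x\<in>J. source_sigma U n x)"

text \<open>The additive terms of the decoder output, one per independent source.
  \<open>Receiver\<close> generates no additive term, hence 0; the receive distortion is absent
  because its law depends on the channels.\<close>

definition contribution ::
  "('w, 'm::finite, 'l::finite, 'u::finite) uplink \<Rightarrow> 'u \<Rightarrow> nat \<Rightarrow> 'u source \<Rightarrow> 'w \<Rightarrow> complex" where
  "contribution U k n x \<omega> = (case x of
      Receiver \<Rightarrow> 0
    | Signal i \<Rightarrow> signal U i n \<omega> * gain U k i n \<omega>
    | Tx_Dist i \<Rightarrow> tx_dist U i n \<omega> * gain U k i n \<omega>
    | Noise \<Rightarrow> row_mult (comb_row U k n \<omega>) (noise U n \<omega>))"

definition contribution_power ::
  "('w, 'm::finite, 'l::finite, 'u::finite) uplink \<Rightarrow> 'u \<Rightarrow> nat \<Rightarrow> 'u source \<Rightarrow> real" where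
  "contribution_power U k n x = (case x of
      Receiver \<Rightarrow> 0
    | Signal i \<Rightarrow> power U i * (LINT \<omega>|PS U. (norm (gain U k i n \<omega>))\<^sup>2)
    | Tx_Dist i \<Rightarrow> (tx_impair U)\<^sup>2 * power U i * (LINT \<omega>|PS U. (norm (gain U k i n \<omega>))\<^sup>2)
    | Noise \<Rightarrow> noise_var U * (LINT \<omega>|PS U. (norm (comb_row U k n \<omega>))\<^sup>2))"

section \<open>Events and conditional laws at one data channel use\<close>

locale data_use = prob_space "PS U"
  for U :: "('w, 'm::finite, 'l::finite, 'u::finite) uplink" +
  fixes k :: 'u and n :: nat
  assumes params: "parameters_ok U" and data: "data_phase_ok U n" and moments: "finite_moments U k n"
begin

lemma indep: "indep_sets (source_sigma U n) UNIV"
  using data by (simp add: data_phase_ok_def)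

lemma power_nonneg: "0 \<le> power U i"
  using params by (simp add: parameters_ok_def)

lemma sigma_algebra_source: "sigma_algebra (space (PS U)) (source_sigma U n x)"
  unfolding source_sigma_def
  by (intro sigma_algebra_sigma_sets) (auto simp: rv_events_def split: source.splits)

lemma source_subset_events: "source_sigma U n x \<subseteq> events"
  using indep by (auto simp: indep_sets_def)

lemma space_known[simp]: "space (known U n J) = space (PS U)"
  by (simp add: known_def space_measure_of_conv)

lemma sets_known: "sets (known U n J) = sigma_sets (space (PS U)) (\<Union>x\<in>J. source_sigma U n x)"
  unfolding known_def using source_subset_events sets.space_closed by (intro sets_measure_of) blast

lemma subalgebra_known: "subalgebra (PS U) (known U n J)"
  unfolding subalgebra_def sets_known using source_subset_events
  by (auto intro!: sets.sigma_sets_subset)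

lemma measurable_known:
  fixes X :: "'w \<Rightarrow> 'b::topological_space"
  assumes "rv_events (PS U) X \<subseteq> source_sigma U n x" "x \<in> J"
  shows "X \<in> borel_measurable (known U n J)"
proof (rule measurableI)
  fix A :: "'b set" assume "A \<in> sets borel"
  then have "X -` A \<inter> space (PS U) \<in> source_sigma U n x" using assms by (auto simp: rv_events_def)
  then show "X -` A \<inter> space (known U n J) \<in> sets (known U n J)"
    unfolding sets_known using assms by (auto intro: sigma_sets.Basic)
qed simp

lemma source_rv_events:
  "rv_events (PS U) (chan U i) \<subseteq> source_sigma U n Receiver"
  "rv_events (PS U) (ap_phase U a t) \<subseteq> source_sigma U n Receiver"
  "rv_events (PS U) (ue_phase U i t) \<subseteq> source_sigma U n Receiver"
  "rv_events (PS U) (combiner U i n) \<subseteq> source_sigma U n Receiver"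
  "rv_events (PS U) (signal U i n) \<subseteq> source_sigma U n (Signal i)"
  "rv_events (PS U) (tx_dist U i n) \<subseteq> source_sigma U n (Tx_Dist i)"
  "rv_events (PS U) (noise U n) \<subseteq> source_sigma U n Noise"
  by (cases a, auto simp: source_sigma_def intro!: sigma_sets.Basic)+

text \<open>Gains are functions of channels, phases and combiners alone, all of which belong to
  \<open>Receiver\<close>.\<close>

lemma measurable_gain_known:
  assumes "Receiver \<in> J"
  shows "(\<lambda>\<omega>. comb_row U k n \<omega> $ a) \<in> borel_measurable (known U n J)"
    and "(\<lambda>\<omega>. gain U k i n \<omega>) \<in> borel_measurable (known U n J)"
proof -
  note m[measurable] = source_rv_events(1-4)[THEN measurable_known, OF assms]
  show c: "(\<lambda>\<omega>. comb_row U k n \<omega> $ a) \<in> borel_measurable (known U n J)" for a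
    unfolding comb_row_nth by measurable
  have [measurable]: "cis \<in> borel_measurable borel"
    by (intro borel_measurable_continuous_onI continuous_intros)
  have "(\<lambda>\<omega>. eff_chan U i n \<omega> $ a) \<in> borel_measurable (known U n J)" for a
    unfolding eff_chan_nth by measurable
  then show "(\<lambda>\<omega>. gain U k i n \<omega>) \<in> borel_measurable (known U n J)"
    by (intro borel_measurable_row_mult c)
qed

lemma measurable_contribution_known:
  assumes "Receiver \<in> J" "x \<in> J"
  shows "contribution U k n x \<in> borel_measurable (known U n J)"
proof -
  note [measurable] = measurable_gain_known[OF assms(1)]
  have "contribution U k n x = (\<lambda>\<omega>. case x of Receiver \<Rightarrow> 0
    | Signal i \<Rightarrow> signal U i n \<omega> * gain U k i n \<omega>
    | Tx_Dist i \<Rightarrow> tx_dist U i n \<omega> * gain U k i n \<omega>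
    | Noise \<Rightarrow> row_mult (comb_row U k n \<omega>) (noise U n \<omega>))"
    by (simp add: contribution_def[abs_def])
  then show ?thesis
    using source_rv_events(5-7)[THEN measurable_known[of _ _ J]] assms(2)
    by (cases x) (auto intro!: borel_measurable_times measurable_gain_known[OF assms(1)]
      borel_measurable_row_mult borel_measurable_vec_nth_complex)
qed

text \<open>A source outside J is independent of what J generates, so its conditional law is its
  unconditional one.\<close>

lemma conditional_kernel_source:
  fixes X :: "'w \<Rightarrow> 'b::topological_space"
  assumes X: "X \<in> borel_measurable (PS U)" and sub: "rv_events (PS U) X \<subseteq> source_sigma U n x" and "x \<notin> J"
  shows "conditional_kernel (PS U) (known U n J) borel X (\<lambda>_. distr (PS U) borel X)"
proof (rule conditional_kernel_indep[OF subalgebra_known X])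
  fix A and B :: "'b set" assume "A \<in> sets (known U n J)" "B \<in> sets borel"
  moreover have "Int_stable (source_sigma U n y)" for y
  proof -
    interpret S: sigma_algebra "space (PS U)" "source_sigma U n y" by (rule sigma_algebra_source)
    show ?thesis by (auto simp: Int_stable_def)
  qed
  ultimately show "prob (A \<inter> (X -` B \<inter> space (PS U))) = prob A * prob (X -` B \<inter> space (PS U))"
    using sub assms(3) by (intro indep_sets_prob_Int[OF indep, of x J]) (auto simp: sets_known rv_events_def)
qed

section \<open>Adding the powers of the sources one at a time\<close>

lemma integrable_gain: "integrable (PS U) (\<lambda>\<omega>. (norm (gain U k i n \<omega>))\<^sup>2)"
  using moments by (simp add: finite_moments_def)

lemma nn_integral_power:
  assumes "0 \<le> p" "integrable (PS U) f" "\<And>\<omega>. 0 \<le> f \<omega>"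
  shows "(\<integral>\<^sup>+\<omega>. ennreal (p * f \<omega>) \<partial>PS U) = ennreal (p * (LINT \<omega>|PS U. f \<omega>))"
  using nn_integral_eq_integral[of "PS U" "\<lambda>\<omega>. p * f \<omega>"] assms by simp

text \<open>Given the receiver, the gain is a constant factor and X times the gain is centred with
  power p |gain|^2. Signals and transmit distortions both have this form.\<close>

lemma nn_integral_add_scalar_source:
  assumes X: "X \<in> borel_measurable (PS U)" and sub: "rv_events (PS U) X \<subseteq> source_sigma U n x"
    and x: "x \<notin> J" "Receiver \<in> J"
    and W: "W \<in> borel_measurable (known U n J)" and c: "centred_law (distr (PS U) borel X) p"
  shows "(\<integral>\<^sup>+\<omega>. ennreal ((norm (W \<omega> + X \<omega> * gain U k i n \<omega>))\<^sup>2) \<partial>PS U) =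
    (\<integral>\<^sup>+\<omega>. ennreal ((norm (W \<omega>))\<^sup>2) \<partial>PS U) + ennreal (p * (LINT \<omega>|PS U. (norm (gain U k i n \<omega>))\<^sup>2))"
proof -
  note [measurable] = measurable_gain_known(2)[OF x(2)]
  note K = conditional_kernel_source[OF X sub x(1)]
  have "(\<integral>\<^sup>+\<omega>. ennreal ((norm (W \<omega> + (\<lambda>(\<omega>, s). s * gain U k i n \<omega>) (\<omega>, X \<omega>)))\<^sup>2) \<partial>PS U) =
    (\<integral>\<^sup>+\<omega>. ennreal ((norm (W \<omega>))\<^sup>2) \<partial>PS U) + (\<integral>\<^sup>+\<omega>. ennreal (p * (norm (gain U k i n \<omega>))\<^sup>2) \<partial>PS U)"
  proof (rule nn_integral_add_conditionally_centred[OF K W])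
    show "(\<lambda>\<omega>. p * (norm (gain U k i n \<omega>))\<^sup>2) \<in> borel_measurable (PS U)"
      using integrable_gain[of i] by (intro borel_measurable_times) auto
  qed (use centred_law_scale[OF c] in auto)
  then show ?thesis
    using nn_integral_power[OF centred_law_nonneg[OF c] integrable_gain] by simp
qed

lemma nn_integral_add_source:
  assumes x: "x \<notin> J" "Receiver \<in> J" and W: "W \<in> borel_measurable (known U n J)"
  shows "(\<integral>\<^sup>+\<omega>. ennreal ((norm (W \<omega> + contribution U k n x \<omega>))\<^sup>2) \<partial>PS U) =
    (\<integral>\<^sup>+\<omega>. ennreal ((norm (W \<omega>))\<^sup>2) \<partial>PS U) + ennreal (contribution_power U k n x)"
proof (cases x)
  case Receiver
  then show ?thesis using x by simp
next
  case (Signal i)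
  have X: "signal U i n \<in> borel_measurable (PS U)" using data by (simp add: data_phase_ok_def)
  have "centred_law (distr (PS U) borel (signal U i n)) (power U i)"
    using data by (intro centred_law_distr prob_space_axioms) (auto simp: data_phase_ok_def)
  from nn_integral_add_scalar_source[OF X source_rv_events(5) _ x(2) W this] x(1)
  show ?thesis by (simp add: Signal contribution_def contribution_power_def)
next
  case (Tx_Dist i)
  have X: "tx_dist U i n \<in> borel_measurable (PS U)" using data by (simp add: data_phase_ok_def)
  have "centred_law (distr (PS U) borel (tx_dist U i n)) ((tx_impair U)\<^sup>2 * power U i)"
    using data power_nonneg[of i] centred_law_complex_normal by (simp add: data_phase_ok_def)
  from nn_integral_add_scalar_source[OF X source_rv_events(6) _ x(2) W this] x(1)
  show ?thesis by (simp add: Tx_Dist contribution_def contribution_power_def)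
next
  case Noise
  have X: "noise U n \<in> borel_measurable (PS U)" using data by (simp add: data_phase_ok_def)
  note K = conditional_kernel_source[OF X source_rv_events(7) x(1)[unfolded Noise]]
  have xi: "0 \<le> noise_var U" using params by (simp add: parameters_ok_def)
  have int: "integrable (PS U) (\<lambda>\<omega>. (norm (comb_row U k n \<omega>))\<^sup>2)"
    using moments by (simp add: finite_moments_def)
  have "(\<integral>\<^sup>+\<omega>. ennreal ((norm (W \<omega> + (\<lambda>z. row_mult (comb_row U k n (fst z)) (snd z)) (\<omega>, noise U n \<omega>)))\<^sup>2) \<partial>PS U) =
    (\<integral>\<^sup>+\<omega>. ennreal ((norm (W \<omega>))\<^sup>2) \<partial>PS U) + (\<integral>\<^sup>+\<omega>. ennreal (noise_var U * (norm (comb_row U k n \<omega>))\<^sup>2) \<partial>PS U)"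
  proof (rule nn_integral_add_conditionally_centred[OF K W])
    show "(\<lambda>z. row_mult (comb_row U k n (fst z)) (snd z)) \<in> borel_measurable (known U n J \<Otimes>\<^sub>M borel)"
      by (intro borel_measurable_row_mult measurable_compose[OF measurable_fst measurable_gain_known(1)[OF x(2)]])
        measurable
    show "(\<lambda>\<omega>. noise_var U * (norm (comb_row U k n \<omega>))\<^sup>2) \<in> borel_measurable (PS U)"
      using int by (intro borel_measurable_times) auto
    fix \<omega>
    have "complex_normal_vec (distr (PS U) borel (noise U n)) (mat (complex_of_real (noise_var U)))"
      using data by (simp add: data_phase_ok_def)
    \<comment> \<open>For a fixed outcome the combining row is deterministic, and the scalar noise
      covariance turns the Hermitian form into a multiple of the squared norm of the row.\<close>
    from centred_law_row_mult[OF this, of "comb_row U k n \<omega>"]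
    show "centred_law (distr (distr (PS U) borel (noise U n)) borel
        (\<lambda>x. row_mult (comb_row U k n (fst (\<omega>, x))) (snd (\<omega>, x)))) (noise_var U * (norm (comb_row U k n \<omega>))\<^sup>2)"
      by (simp add: herm_form_scalar)
  qed
  then show ?thesis
    using nn_integral_power[OF xi int] by (simp add: Noise contribution_def contribution_power_def)
qed

lemma contribution_power_nonneg: "0 \<le> contribution_power U k n x"
  using power_nonneg params
  by (cases x) (auto simp: contribution_power_def parameters_ok_def intro!: mult_nonneg_nonneg)

text \<open>Induction on J: each new source is centred given the receiver and the sources already
  added. The free shift w serves the variance criterion; w = 0 gives the power.\<close>

lemma nn_integral_sum_sources:
  assumes "finite J" "Receiver \<notin> J"
  shows "(\<integral>\<^sup>+\<omega>. ennreal ((norm (w + (\<Sum>x\<in>J. contribution U k n x \<omega>)))\<^sup>2) \<partial>PS U) =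
    ennreal ((norm w)\<^sup>2) + ennreal (\<Sum>x\<in>J. contribution_power U k n x)"
  using assms
proof induction
  case empty
  then show ?case by (simp add: emeasure_space_1)
next
  case (insert x J)
  have "(\<lambda>\<omega>. w + (\<Sum>x\<in>J. contribution U k n x \<omega>)) \<in> borel_measurable (known U n (insert Receiver J))"
    by (intro borel_measurable_add borel_measurable_sum measurable_contribution_known) auto
  moreover have "x \<notin> insert Receiver J" using insert by auto
  ultimately
  have "(\<integral>\<^sup>+\<omega>. ennreal ((norm (w + (\<Sum>x\<in>J. contribution U k n x \<omega>) + contribution U k n x \<omega>))\<^sup>2) \<partial>PS U) =
    ennreal ((norm w)\<^sup>2) + ennreal (\<Sum>x\<in>J. contribution_power U k n x) + ennreal (contribution_power U k n x)"
    using nn_integral_add_source[of x "insert Receiver J" "\<lambda>\<omega>. w + (\<Sum>x\<in>J. contribution U k n x \<omega>)"] insert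
    by simp
  then show ?case
    using insert contribution_power_nonneg
    by (simp add: add_ac sum_nonneg flip: ennreal_plus)
qed

text \<open>Given all other sources, the combined receive distortion is a centred Gaussian whose
  variance is the quadratic form. Being conditional on everything else, it can be added to any W
  built from those sources.\<close>

lemma nn_integral_add_rx_dist:
  assumes W: "W \<in> borel_measurable (known U n UNIV)"
  shows "(\<integral>\<^sup>+\<omega>. ennreal ((norm (W \<omega> + rx_dist_output U k n \<omega>))\<^sup>2) \<partial>PS U) =
    (\<integral>\<^sup>+\<omega>. ennreal ((norm (W \<omega>))\<^sup>2) \<partial>PS U) + ennreal (rx_dist_power U k n)"
    and "0 \<le> rx_dist_power U k n"
proof -
  have X: "rx_dist U n \<in> borel_measurable (PS U)" using data by (simp add: data_phase_ok_def)
  let ?G = "sets (known U n UNIV)"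
  \<comment> \<open>The assumed kernel is measurable for the sigma-algebra generated by
    \<open>?G\<close>; since \<open>?G\<close> is already a sigma-algebra, this is measurability for
    \<open>known U n UNIV\<close>.\<close>
  have G: "sets (sigma (space (PS U)) ?G) = ?G"
    using sets.sets_measure_of_eq[of "known U n UNIV"] by simp
  have "cond_complex_normal (PS U) ?G (rx_dist U n) (rx_dist_cov U)"
    unfolding sets_known using data by (simp add: data_phase_ok_def)
  then obtain \<kappa> where \<kappa>: "\<kappa> \<in> known U n UNIV \<rightarrow>\<^sub>M prob_algebra borel"
      "\<And>\<omega>. \<omega> \<in> space (PS U) \<Longrightarrow> complex_normal_vec (\<kappa> \<omega>) (rx_dist_cov U \<omega>)"
      "\<forall>A\<in>?G. \<forall>B\<in>sets borel. emeasure (PS U) (A \<inter> rx_dist U n -` B) = (\<integral>\<^sup>+\<omega>\<in>A. emeasure (\<kappa> \<omega>) B \<partial>PS U)"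
    unfolding cond_complex_normal_def measurable_cong_sets[OF G refl] by blast
  then have K: "conditional_kernel (PS U) (known U n UNIV) borel (rx_dist U n) \<kappa>"
    using X subalgebra_known by (simp add: conditional_kernel_def)
  have int: "integrable (PS U) (rx_dist_form U k n)" using moments by (simp add: finite_moments_def)
  have c: "centred_law (distr (\<kappa> \<omega>) borel (row_mult (comb_row U k n \<omega>))) (Re (rx_dist_form U k n \<omega>))"
    if "\<omega> \<in> space (PS U)" for \<omega>
    using centred_law_row_mult[OF \<kappa>(2)[OF that]] by (simp add: rx_dist_form_eq)
  \<comment> \<open>The form is nonnegative because it is the second moment of a law.\<close>
  have nn: "AE \<omega> in PS U. 0 \<le> Re (rx_dist_form U k n \<omega>)"
    using centred_law_nonneg[OF c] by (intro AE_I2)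
  have re: "rx_dist_power U k n = (LINT \<omega>|PS U. Re (rx_dist_form U k n \<omega>))"
    using int by (simp add: rx_dist_power_def)
  then show "0 \<le> rx_dist_power U k n" using nn by (simp add: integral_nonneg_AE)
  have "(\<integral>\<^sup>+\<omega>. ennreal ((norm (W \<omega> + (\<lambda>z. row_mult (comb_row U k n (fst z)) (snd z)) (\<omega>, rx_dist U n \<omega>)))\<^sup>2) \<partial>PS U) =
    (\<integral>\<^sup>+\<omega>. ennreal ((norm (W \<omega>))\<^sup>2) \<partial>PS U) + (\<integral>\<^sup>+\<omega>. ennreal (Re (rx_dist_form U k n \<omega>)) \<partial>PS U)"
  proof (rule nn_integral_add_conditionally_centred[OF K W])
    show "(\<lambda>z. row_mult (comb_row U k n (fst z)) (snd z)) \<in> borel_measurable (known U n UNIV \<Otimes>\<^sub>M borel)"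
      by (intro borel_measurable_row_mult measurable_compose[OF measurable_fst measurable_gain_known(1)[OF UNIV_I]])
        measurable
  qed (use int c in auto)
  also have "(\<integral>\<^sup>+\<omega>. ennreal (Re (rx_dist_form U k n \<omega>)) \<partial>PS U) = ennreal (rx_dist_power U k n)"
    unfolding re using int nn by (intro nn_integral_eq_integral) auto
  finally show "(\<integral>\<^sup>+\<omega>. ennreal ((norm (W \<omega> + rx_dist_output U k n \<omega>))\<^sup>2) \<partial>PS U) =
    (\<integral>\<^sup>+\<omega>. ennreal ((norm (W \<omega>))\<^sup>2) \<partial>PS U) + ennreal (rx_dist_power U k n)"
    by (simp add: rx_dist_output_def)
qed

section \<open>Variances of the two distortion outputs\<close>

lemma rx_dist_power_nonneg: "0 \<le> rx_dist_power U k n"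
  using nn_integral_add_rx_dist(2)[of "\<lambda>_. 0"] by simp

lemma measurable_contribution: "contribution U k n x \<in> borel_measurable (PS U)"
  using measurable_from_subalg[OF subalgebra_known measurable_contribution_known] by blast

lemma measurable_rx_dist_output: "rx_dist_output U k n \<in> borel_measurable (PS U)"
proof -
  have "rx_dist U n \<in> borel_measurable (PS U)" using data by (simp add: data_phase_ok_def)
  then show ?thesis
    unfolding rx_dist_output_def[abs_def]
    by (intro borel_measurable_row_mult borel_measurable_vec_nth_complex
        measurable_from_subalg[OF subalgebra_known measurable_gain_known(1)[OF UNIV_I]])
qed

lemma variance_rx_dist_output: "complex_variance (PS U) (rx_dist_output U k n) = rx_dist_power U k n"
  using nn_integral_add_rx_dist(1)[of "\<lambda>_. w" for w] rx_dist_power_nonneg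
  by (intro complex_variance_eqI measurable_rx_dist_output) (simp_all add: emeasure_space_1)

lemma variance_tx_dist_output: "complex_variance (PS U) (tx_dist_output U k n) = tx_dist_power U k n"
proof -
  have eq: "tx_dist_output U k n = (\<lambda>\<omega>. \<Sum>x\<in>range Tx_Dist. contribution U k n x \<omega>)"
    by (auto simp: tx_dist_output_def row_mult_sum row_mult_scale sum.reindex inj_on_def contribution_def)
  have eq2: "tx_dist_power U k n = (\<Sum>x\<in>range Tx_Dist. contribution_power U k n x)"
    by (simp add: tx_dist_power_def sum.reindex inj_on_def contribution_power_def)
  show ?thesis
    unfolding eq eq2 
    by (intro complex_variance_eqI nn_integral_sum_sources sum_nonneg contribution_power_nonneg
        borel_measurable_sum measurable_contribution) auto
qed

section \<open>The spectral efficiency of one channel use\<close>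

text \<open>The sources other than the symbol of user \<open>k\<close>, whose place is taken by the channel input.\<close>

definition interferers :: "'u source set" where
  "interferers = Signal ` (UNIV - {k}) \<union> range Tx_Dist \<union> {Noise}"

lemma finite_interferers: "finite interferers" "Receiver \<notin> interferers"
  by (auto simp: interferers_def)

lemma sum_interferers:
  "(\<Sum>x\<in>interferers. f x) = (\<Sum>i\<in>UNIV - {k}. f (Signal i)) + (\<Sum>i\<in>UNIV. f (Tx_Dist i)) + f Noise"
  for f :: "'u source \<Rightarrow> 'c::comm_monoid_add"
proof -
  have "(\<Sum>x\<in>interferers. f x) = (\<Sum>x\<in>Signal ` (UNIV - {k}). f x) + (\<Sum>x\<in>range Tx_Dist. f x) + f Noise"
    unfolding interferers_def by (subst sum.union_disjoint; (subst sum.union_disjoint)?) auto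
  then show ?thesis by (simp add: sum.reindex inj_on_def)
qed

text \<open>The noise Z of the scalar channel: all of the decoder output except the term carrying
  the input of user \<open>k\<close>.\<close>

definition disturbance :: "'w \<Rightarrow> complex" where
  "disturbance \<omega> = (\<Sum>x\<in>interferers. contribution U k n x \<omega>) + rx_dist_output U k n \<omega>"

lemma estimate_eq:
  "estimate U k n ((\<lambda>i. signal U i n \<omega>)(k := x)) \<omega> = x * gain U k k n \<omega> + disturbance \<omega>"
proof -
  define s where "s = (\<lambda>i. signal U i n \<omega>)(k := x)"
  have "estimate U k n s \<omega> = (\<Sum>i\<in>UNIV. s i * gain U k i n \<omega>) + (\<Sum>i\<in>UNIV. tx_dist U i n \<omega> * gain U k i n \<omega>)
      + row_mult (comb_row U k n \<omega>) (noise U n \<omega>) + rx_dist_output U k n \<omega>"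
    by (simp add: estimate_def received_def row_mult_add row_mult_sum row_mult_scale rx_dist_output_def
        distrib_right sum.distrib)
  also have "(\<Sum>i\<in>UNIV. s i * gain U k i n \<omega>) =
      x * gain U k k n \<omega> + (\<Sum>i\<in>UNIV - {k}. signal U i n \<omega> * gain U k i n \<omega>)"
    by (subst sum.remove[of _ k]) (auto simp: s_def intro!: sum.cong)
  finally have "estimate U k n s \<omega> = x * gain U k k n \<omega> + disturbance \<omega>"
    by (simp add: disturbance_def sum_interferers contribution_def)
  then show ?thesis by (simp only: s_def)
qed

lemma disturbance_power:
  "has_bochner_integral (PS U) (\<lambda>\<omega>. (norm (disturbance \<omega>))\<^sup>2)
     ((\<Sum>x\<in>interferers. contribution_power U k n x) + rx_dist_power U k n)"
proof (rule has_bochner_integral_nn_integral)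
  have "(\<lambda>\<omega>. \<Sum>x\<in>interferers. contribution U k n x \<omega>) \<in> borel_measurable (known U n UNIV)"
    by (intro borel_measurable_sum measurable_contribution_known) auto
  from nn_integral_add_rx_dist(1)[OF this] nn_integral_sum_sources[OF finite_interferers, of 0]
  show "(\<integral>\<^sup>+\<omega>. ennreal ((norm (disturbance \<omega>))\<^sup>2) \<partial>PS U) =
    ennreal ((\<Sum>x\<in>interferers. contribution_power U k n x) + rx_dist_power U k n)"
    using rx_dist_power_nonneg
    by (simp add: disturbance_def sum_nonneg contribution_power_nonneg)
  show "0 \<le> (\<Sum>x\<in>interferers. contribution_power U k n x) + rx_dist_power U k n"
    using rx_dist_power_nonneg
    by (simp add: sum_nonneg contribution_power_nonneg)
  show "(\<lambda>\<omega>. (norm (disturbance \<omega>))\<^sup>2) \<in> borel_measurable (PS U)"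
    unfolding disturbance_def using measurable_contribution measurable_rx_dist_output by measurable
qed simp

text \<open>The Gaussian law is one admissible input, so the supremum dominates its mutual
  information.\<close>

lemma channel_use_SE_ge: "ereal (log 2 (1 + SINR_lo U k n)) \<le> channel_use_SE U k n"
proof -
  have g: "(\<lambda>\<omega>. gain U k k n \<omega>) \<in> borel_measurable (PS U)"
    by (rule measurable_from_subalg[OF subalgebra_known measurable_gain_known(2)[OF UNIV_I]])
  have d: "disturbance \<in> borel_measurable (PS U)"
    unfolding disturbance_def[abs_def] using measurable_contribution measurable_rx_dist_output by measurable
  have dp: "integrable (PS U) (\<lambda>\<omega>. (norm (disturbance \<omega>))\<^sup>2)"
    "(LINT \<omega>|PS U. (norm (disturbance \<omega>))\<^sup>2) = (\<Sum>x\<in>interferers. contribution_power U k n x) + rx_dist_power U k n"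
    using disturbance_power by (auto simp: has_bochner_integral_iff)
  \<comment> \<open>The denominator of the SINR is exactly the effective noise power of the scalar
    channel: gain fluctuation plus disturbance.\<close>
  have I: "interference_power U k n =
      power U k * complex_variance (PS U) (gain U k k n) + (LINT \<omega>|PS U. (norm (disturbance \<omega>))\<^sup>2)"
    unfolding dp(2) sum_interferers
    by (simp add: interference_power_def contribution_power_def tx_dist_power_def)
  have "ereal (log 2 (1 + SINR_lo U k n)) \<le> mutual_info (complex_normal (power U k) \<Otimes>\<^sub>M PS U) fst
      (\<lambda>(x, \<omega>). estimate U k n ((\<lambda>i. signal U i n \<omega>)(k := x)) \<omega>)"
    using mutual_info_gaussian_input[OF prob_space_axioms g d integrable_gain dp(1) power_nonneg[of k]]
    unfolding estimate_eq SINR_lo_def signal_power_def I .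
  also have "\<dots> \<le> channel_use_SE U k n"
    unfolding channel_use_SE_def
  proof (rule SUP_upper)
    show "complex_normal (power U k) \<in> input_laws (power U k)"
      using centred_law_complex_normal[OF power_nonneg[of k]] by (simp add: input_laws_def centred_law_def)
  qed
  finally show ?thesis .
qed

end

section \<open>Averaging over the data channel uses\<close>

theorem proposition4:
  fixes U :: "('w, 'm::finite, 'l::finite, 'u::finite) uplink" and k :: 'u
  assumes "uplink_system U"
    and "\<And>n. n \<in> data_uses U \<Longrightarrow> finite_moments U k n"
  shows "ereal (SE_lo U k) \<le> average_SE U k \<and>
    (\<forall>n\<in>data_uses U.
       complex_variance (PS U) (tx_dist_output U k n) = tx_dist_power U k n \<and>
       complex_variance (PS U) (rx_dist_output U k n) = rx_dist_power U k n)"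
proof -
  have use: "data_use U k n" if "n \<in> data_uses U" for n
    using assms that by (simp add: uplink_system_def data_use_def data_use_axioms_def)
  \<comment> \<open>Blocks contain at least one pilot use, so the block length is positive and
    division by it in \<open>ereal\<close> is ordinary and monotone.\<close>
  have b: "0 < block_len U" using assms(1) by (simp add: uplink_system_def parameters_ok_def)
  have "ereal (SE_lo U k) = (\<Sum>n\<in>data_uses U. ereal (log 2 (1 + SINR_lo U k n))) / ereal (real (block_len U))"
    using b by (simp add: SE_lo_def)
  also have "\<dots> \<le> average_SE U k"
    unfolding average_SE_def using b data_use.channel_use_SE_ge[OF use]
    by (intro ereal_divide_right_mono sum_mono) auto
  finally show ?thesis
    using data_use.variance_tx_dist_output[OF use] data_use.variance_rx_dist_output[OF use] by blast
qed

end
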